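(* Suppose $Y^*\in\mathcal L^1(\mathcal Q)$, $\rho_{\mathcal Q}$ is continuous from above at $0$, and assumption (A) holds: there exists $\lambda\in(0,1)$ such that for all $\tau_1,\tau_2\in\mathcal T_f\setminus\{0\}$, $$\inf_{A\in\mathcal F_{\tau_1\wedge\tau_2}}\rho_{\mathcal Q}\big((\mathbb 1_A-\lambda)(Y_{\tau_2}-Y_{\tau_1})\big)\le0.$$ Then $$\sup_{\tau\in\mathcal T}\inf_{\mathrm Q\in\mathcal Q}\mathbb E_{\mathrm Q}[Y_\tau]=\sup_{\tau\in\mathcal T}\inf_{\mathrm Q\in co(\mathcal Q)}\mathbb E_{\mathrm Q}[Y_\tau]=\inf_{\mathrm Q\in co(\mathcal Q)}\sup_{\tau\in\mathcal T}\mathbb E_{\mathrm Q}[Y_\tau].$$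
   Context: Let $0<T<\infty$ and let $(\Omega,\mathcal F,(\mathcal F_t)_{0\le t\le T},\mathrm P)$ be a filtered probability space with right-continuous filtration, $\mathcal F=\mathcal F_T$, and $\mathcal F_0$ containing only sets of probability $0$ or $1$ as well as all $\mathrm P$-null sets of $\mathcal F_T$. $\mathcal T$ denotes the set of all stopping times $\tau\le T$ w.r.t. $(\mathcal F_t)$, and $\mathcal T_f$ the set of those with finite range; $\mathcal T_f\setminus\{0\}$ excludes the stopping time identically $0$. $\mathcal Q$ is a nonempty set of probability measures on $\mathcal F$, each absolutely continuous w.r.t. $\mathrm P$, and $co(\mathcal Q)$ is its convex hull. $\mathcal L^1(\mathcal Q)$ is the set of random variables $X$ with $\sup_{\mathrm Q\in\mathcal Q}\mathbb E_{\mathrm Q}[|X|]<\infty$. $Y=(Y_t)_{0\le t\le T}$ is a right-continuous $(\mathcal F_t)$-adapted process with bounded paths which is quasi left-uppersemicontinuous w.r.t. $\mathrm P$, i.e. $\limsup_n Y_{\tau_n}\le Y_\tau$ $\mathrm P$-a.s. whenever $\tau_n\in\mathcal T$, $\tau_n\nearrow\tau\in\mathcal T$. $Y^*:=\sup_{t\in[0,T]}|Y_t|$. $\mathcal X$ is the set of random variables $X$ with $|X|\le C(Y^*+1)$ $\mathrm P$-a.s. for some $C>0$, and $\rho_{\mathcal Q}:\mathcal X\to\mathbb R$, $\rho_{\mathcal Q}(X)=\sup_{\mathrm Q\in\mathcal Q}\mathbb E_{\mathrm Q}[X]$. $\rho_{\mathcal Q}$ is called continuous from above at $0$ if $\rho_{\mathcal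 Q}(X_n)\searrow0$ whenever $X_n\in\mathcal X$ and $X_n\searrow0$ $\mathrm P$-a.s. *)

theory Defs
  imports "HOL-Probability.Probability"
begin

text \<open>Standing setting. The time horizon is \<open>T\<close>, the time set is \<open>{0..T}\<close>.
  \<open>P\<close> is the reference probability measure on \<open>\<F> = \<F>_T\<close>, and \<open>F t\<close> is the
  sigma-algebra \<open>\<F>_t\<close> (as a measure whose space is the sample space).\<close>

definition filtered_setting :: "'a measure \<Rightarrow> (real \<Rightarrow> 'a measure) \<Rightarrow> real \<Rightarrow> bool" where
  "filtered_setting P F T \<longleftrightarrow>
     prob_space P \<and> 0 < T \<and>
     (\<forall>t\<in>{0..T}. space (F t) = space P \<and> sets (F t) \<subseteq> sets P) \<and>
     (\<forall>s t. 0 \<le> s \<longrightarrow> s \<le> t \<longrightarrow> t \<le> T \<longrightarrow> sets (F s) \<subseteq> sets (F t)) \<and>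
     \<comment> \<open>right-continuity of the filtration\<close>
     (\<forall>t\<in>{0..<T}. sets (F t) = (\<Inter>s\<in>{t<..T}. sets (F s))) \<and>
     \<comment> \<open>\<open>\<F> = \<F>_T\<close>\<close>
     sets (F T) = sets P \<and>
     \<comment> \<open>\<open>\<F>_0\<close> is P-trivial and contains all P-null sets of \<open>\<F>_T\<close>\<close>
     (\<forall>A\<in>sets (F 0). measure P A = 0 \<or> measure P A = 1) \<and>
     (\<forall>A\<in>sets P. measure P A = 0 \<longrightarrow> A \<in> sets (F 0))"

definition stopping_times :: "'a measure \<Rightarrow> (real \<Rightarrow> 'a measure) \<Rightarrow> real \<Rightarrow> ('a \<Rightarrow> real) set" where
  "stopping_times P F T =
     {\<tau>. (\<forall>\<omega>\<in>space P. \<tau> \<omega> \<in> {0..T}) \<and>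
         (\<forall>t\<in>{0..T}. {\<omega>\<in>space P. \<tau> \<omega> \<le> t} \<in> sets (F t))}"

definition finite_stopping_times :: "'a measure \<Rightarrow> (real \<Rightarrow> 'a measure) \<Rightarrow> real \<Rightarrow> ('a \<Rightarrow> real) set" where
  "finite_stopping_times P F T = {\<tau>\<in>stopping_times P F T. finite (\<tau> ` space P)}"

definition nonzero_finite_stopping_times :: "'a measure \<Rightarrow> (real \<Rightarrow> 'a measure) \<Rightarrow> real \<Rightarrow> ('a \<Rightarrow> real) set" where
  "nonzero_finite_stopping_times P F T =
     {\<tau>\<in>finite_stopping_times P F T. \<not> (\<forall>\<omega>\<in>space P. \<tau> \<omega> = 0)}"

definition stopped_sets :: "'a measure \<Rightarrow> (real \<Rightarrow> 'a measure) \<Rightarrow> real \<Rightarrow> ('a \<Rightarrow> real) \<Rightarrow> 'a set set" where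
  "stopped_sets P F T \<tau> =
     {A\<in>sets P. \<forall>t\<in>{0..T}. A \<inter> {\<omega>\<in>space P. \<tau> \<omega> \<le> t} \<in> sets (F t)}"

definition stopped :: "(real \<Rightarrow> 'a \<Rightarrow> real) \<Rightarrow> ('a \<Rightarrow> real) \<Rightarrow> 'a \<Rightarrow> real" where
  "stopped Y \<tau> = (\<lambda>\<omega>. Y (\<tau> \<omega>) \<omega>)"

definition Ystar :: "real \<Rightarrow> (real \<Rightarrow> 'a \<Rightarrow> real) \<Rightarrow> 'a \<Rightarrow> real" where
  "Ystar T Y = (\<lambda>\<omega>. SUP t\<in>{0..T}. \<bar>Y t \<omega>\<bar>)"

definition admissible_process :: "'a measure \<Rightarrow> (real \<Rightarrow> 'a measure) \<Rightarrow> real \<Rightarrow> (real \<Rightarrow> 'a \<Rightarrow> real) \<Rightarrow> bool" where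
  "admissible_process P F T Y \<longleftrightarrow>
     (\<forall>t\<in>{0..T}. Y t \<in> borel_measurable (F t)) \<and>
     (\<forall>\<omega>\<in>space P. \<forall>t\<in>{0..<T}. continuous (at_right t) (\<lambda>s. Y s \<omega>)) \<and>
     (\<forall>\<omega>\<in>space P. bounded ((\<lambda>t. Y t \<omega>) ` {0..T})) \<and>
     (\<forall>\<sigma> \<tau>. (\<forall>n. \<sigma> n \<in> stopping_times P F T) \<longrightarrow> \<tau> \<in> stopping_times P F T \<longrightarrow>
        (\<forall>\<omega>\<in>space P. incseq (\<lambda>n. \<sigma> n \<omega>) \<and> (\<lambda>n. \<sigma> n \<omega>) \<longlonglongrightarrow> \<tau> \<omega>) \<longrightarrow>
        (AE \<omega> in P. limsup (\<lambda>n. ereal (Y (\<sigma> n \<omega>) \<omega>)) \<le> ereal (Y (\<tau> \<omega>) \<omega>)))"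

definition admissible_measures :: "'a measure \<Rightarrow> 'a measure set \<Rightarrow> bool" where
  "admissible_measures P Qs \<longleftrightarrow> Qs \<noteq> {} \<and>
     (\<forall>Q\<in>Qs. prob_space Q \<and> sets Q = sets P \<and> absolutely_continuous P Q)"

definition conv_measures :: "'a measure \<Rightarrow> 'a measure set \<Rightarrow> 'a measure set" where
  "conv_measures P Qs =
     {Q. sets Q = sets P \<and>
         (\<exists>S w. finite S \<and> S \<noteq> {} \<and> S \<subseteq> Qs \<and> (\<forall>R\<in>S. 0 \<le> w R) \<and> sum w S = (1::real) \<and>
            (\<forall>A\<in>sets P. emeasure Q A = (\<Sum>R\<in>S. ennreal (w R) * emeasure R A)))}"

definition L1Q :: "'a measure \<Rightarrow> 'a measure set \<Rightarrow> ('a \<Rightarrow> real) set" where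
  "L1Q P Qs = {X. X \<in> borel_measurable P \<and> (SUP Q\<in>Qs. \<integral>\<^sup>+ \<omega>. ennreal \<bar>X \<omega>\<bar> \<partial>Q) < \<infinity>}"

definition Xspace :: "'a measure \<Rightarrow> real \<Rightarrow> (real \<Rightarrow> 'a \<Rightarrow> real) \<Rightarrow> ('a \<Rightarrow> real) set" where
  "Xspace P T Y = {X. X \<in> borel_measurable P \<and>
     (\<exists>C>0. AE \<omega> in P. \<bar>X \<omega>\<bar> \<le> C * (Ystar T Y \<omega> + 1))}"

definition rhoQ :: "'a measure set \<Rightarrow> ('a \<Rightarrow> real) \<Rightarrow> real" where
  "rhoQ Qs X = (SUP Q\<in>Qs. \<integral>\<omega>. X \<omega> \<partial>Q)"

definition continuous_from_above_at_0 :: "'a measure \<Rightarrow> real \<Rightarrow> (real \<Rightarrow> 'a \<Rightarrow> real) \<Rightarrow> 'a measure set \<Rightarrow> bool" where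
  "continuous_from_above_at_0 P T Y Qs \<longleftrightarrow>
     (\<forall>X::nat \<Rightarrow> 'a \<Rightarrow> real. (\<forall>n. X n \<in> Xspace P T Y) \<longrightarrow>
        (AE \<omega> in P. decseq (\<lambda>n. X n \<omega>) \<and> (\<lambda>n. X n \<omega>) \<longlonglongrightarrow> 0) \<longrightarrow>
        decseq (\<lambda>n. rhoQ Qs (X n)) \<and> (\<lambda>n. rhoQ Qs (X n)) \<longlonglongrightarrow> 0)"

end

theory Submission
  imports Defs
begin

text \<open>Represent each \<open>Q\<close> in the convex hull by \<open>g = (Ystar + 1) dQ/dP\<close> and each stopping time
  by \<open>X = Y_\<tau> / (Ystar + 1)\<close>, so that \<open>E_Q[Y_\<tau>] = \<integral> g X dP\<close> with \<open>|X| \<le> 1\<close>. Assumption (A) says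
  that pasting makes the set of \<open>X\<close> approximately concave, uniformly in \<open>g\<close>; this yields the minimax
  equality for finitely many stopping times. Continuity from above makes the set of \<open>g\<close> uniformly
  integrable, and then compactness arguments can be replaced by a sequence: choose \<open>g_n\<close> nearly
  minimal against a finite set of \<open>X\<close> that is a net for the functionals on \<open>g_0, ..., g_(n-1)\<close>.
  By a parallelogram argument some convex combination of \<open>g_0, ..., g_(n-1)\<close> is \<open>L1\<close>-close to one
  of \<open>g_n, g_(n+1), ...\<close>, which bounds the upper value by the lower value.\<close>

section \<open>Minimax for finitely many functions\<close>

text \<open>The obstacle is that neither side is compact: \<open>Qs\<close> is not assumed closed,
  so a limit of minimizing densities may leave the hull. The argument therefore never passes to a
  limit; it compares finitely many members of both sets and sends the errors to 0 at the end. Even a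
  uniformly integrable sequence of densities need not have an L1-convergent subsequence; only its
  convex combinations come close to each other, which suffices because payoffs are affine in the
  density. The order of choices removes a circularity: the stopping time that is good for a
  combination of the first \<open>n\<close> densities is known only after that combination, but a
  net fixed in advance contains a substitute for it, and all later densities were chosen against
  that net. Dividing payoffs by \<open>Ystar + 1\<close> bounds them by 1, so L1-closeness of two
  densities controls them uniformly over stopping times. Assumption (A) offers a single weight
  \<open>lam\<close>; all other weights have to be generated from it before a separation argument
  can start.\<close>

lemma approx_concave_all_weights:
  fixes h :: "'c \<Rightarrow> 'b \<Rightarrow> real"
  assumes lam: "0 < lam" "lam < 1"
    and bound: "\<And>c g. c \<in> C \<Longrightarrow> g \<in> G \<Longrightarrow> \<bar>h c g\<bar> \<le> B"
    and mix: "\<And>c1 c2 e. c1 \<in> C \<Longrightarrow> c2 \<in> C \<Longrightarrow> 0 < e \<Longrightarrow>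
        \<exists>c\<in>C. \<forall>g\<in>G. lam * h c1 g + (1 - lam) * h c2 g - e \<le> h c g"
    and t: "0 \<le> t" "t \<le> 1" and c: "c1 \<in> C" "c2 \<in> C" and e: "0 < e"
  shows "\<exists>c\<in>C. \<forall>g\<in>G. t * h c1 g + (1 - t) * h c2 g - e \<le> h c g"
proof -
  \<comment> \<open>\<open>D\<close> collects the weights that work for all pairs and all errors at
    once. It contains 0 and 1 and is closed under \<open>lam\<close>-mixing, hence dense in [0,1];
    boundedness of \<open>h\<close> then carries the inequality from a nearby weight to
    \<open>t\<close>. Quantifying over every error inside \<open>D\<close> keeps errors from
    accumulating along the iteration.\<close>
  define D where "D = {s. \<forall>c1\<in>C. \<forall>c2\<in>C. \<forall>e>0. \<exists>c\<in>C. \<forall>g\<in>G. s * h c1 g + (1 - s) * h c2 g - e \<le> h c g}"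
  have D01: "0 \<in> D" "1 \<in> D"
    unfolding D_def by force+
  have D_mix: "lam * r + (1 - lam) * s \<in> D" if "r \<in> D" "s \<in> D" for r s
    unfolding D_def
  proof (intro CollectI ballI allI impI)
    fix c1 c2 and e :: real assume c: "c1 \<in> C" "c2 \<in> C" and "0 < e"
    then have e2: "0 < e / 2" by simp
    obtain a where a: "a \<in> C" "\<forall>g\<in>G. r * h c1 g + (1 - r) * h c2 g - e/2 \<le> h a g"
      using \<open>r \<in> D\<close> c e2 unfolding D_def by blast
    obtain b where b: "b \<in> C" "\<forall>g\<in>G. s * h c1 g + (1 - s) * h c2 g - e/2 \<le> h b g"
      using \<open>s \<in> D\<close> c e2 unfolding D_def by blast
    obtain d where d: "d \<in> C" "\<forall>g\<in>G. lam * h a g + (1 - lam) * h b g - e/2 \<le> h d g"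
      using mix[OF a(1) b(1) e2] by blast
    show "\<exists>d\<in>C. \<forall>g\<in>G. (lam * r + (1 - lam) * s) * h c1 g + (1 - (lam * r + (1 - lam) * s)) * h c2 g - e \<le> h d g"
    proof (intro bexI[OF _ d(1)] ballI)
      fix g assume g: "g \<in> G"
      have "lam * (r * h c1 g + (1 - r) * h c2 g - e/2) \<le> lam * h a g"
        using lam a(2) g by (intro mult_left_mono) auto
      moreover have "(1 - lam) * (s * h c1 g + (1 - s) * h c2 g - e/2) \<le> (1 - lam) * h b g"
        using lam b(2) g by (intro mult_left_mono) auto
      moreover have "lam * h a g + (1 - lam) * h b g - e/2 \<le> h d g"
        using d g by auto
      moreover have "(lam * r + (1 - lam) * s) * h c1 g + (1 - (lam * r + (1 - lam) * s)) * h c2 g - e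
          = lam * (r * h c1 g + (1 - r) * h c2 g - e/2) + (1 - lam) * (s * h c1 g + (1 - s) * h c2 g - e/2) - e/2"
        by (simp add: field_simps)
      ultimately show "(lam * r + (1 - lam) * s) * h c1 g + (1 - (lam * r + (1 - lam) * s)) * h c2 g - e \<le> h d g"
        by linarith
    qed
  qed
  \<comment> \<open>Splitting an interval at its \<open>lam\<close>-mixture leaves pieces of
    relative length \<open>lam\<close> and \<open>1 - lam\<close>; \<open>q\<close> bounds
    both.\<close>
  define q where "q = max lam (1 - lam)"
  have q: "0 < q" "q < 1" "lam \<le> q" "1 - lam \<le> q" using lam by (auto simp: q_def)
  have bracket: "\<exists>a\<in>D. \<exists>b\<in>D. a \<le> t \<and> t \<le> b \<and> b - a \<le> q ^ n" for n
  proof (induction n)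
    case 0
    then show ?case using D01 t by force
  next
    case (Suc n)
    then obtain a b where ab: "a \<in> D" "b \<in> D" "a \<le> t" "t \<le> b" "b - a \<le> q ^ n" by blast
    define m where "m = lam * a + (1 - lam) * b"
    have m: "m \<in> D" unfolding m_def by (rule D_mix[OF ab(1,2)])
    show ?case
    proof (cases "t \<le> m")
      case True
      have "m - a = (1 - lam) * (b - a)" by (simp add: m_def algebra_simps)
      also have "\<dots> \<le> q * q ^ n" using ab q lam by (intro mult_mono) auto
      finally show ?thesis using True ab m by auto
    next
      case False
      have "b - m = lam * (b - a)" by (simp add: m_def algebra_simps)
      also have "\<dots> \<le> q * q ^ n" using ab q lam by (intro mult_mono) auto
      finally show ?thesis using False ab m by (intro bexI[OF _ m] bexI[OF _ ab(2)]) auto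
    qed
  qed
  \<comment> \<open>Twice the absolute value of \<open>B\<close> bounds the change per unit of
    weight; adding 1 allows division by \<open>K\<close>.\<close>
  define K where "K = 2 * \<bar>B\<bar> + 1"
  have K: "0 < K" by (simp add: K_def)
  have "(\<lambda>n. q ^ n) \<longlonglongrightarrow> 0" using q by (intro LIMSEQ_power_zero) auto
  then have "\<forall>\<^sub>F n in sequentially. q ^ n < e / (2 * K)"
    using e K by (intro order_tendstoD) auto
  then obtain n where n: "q ^ n < e / (2 * K)"
    by (auto simp: eventually_sequentially)
  obtain a b where ab: "a \<in> D" "b \<in> D" "a \<le> t" "t \<le> b" "b - a \<le> q ^ n"
    using bracket by blast
  have "0 < e / 2" using e by simp
  then obtain d where d: "d \<in> C" "\<forall>g\<in>G. a * h c1 g + (1 - a) * h c2 g - e/2 \<le> h d g"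
    using ab(1) c unfolding D_def by blast
  show ?thesis
  proof (intro bexI[OF _ d(1)] ballI)
    fix g assume g: "g \<in> G"
    have "\<bar>h c1 g - h c2 g\<bar> \<le> K"
      using bound[OF c(1) g] bound[OF c(2) g] by (auto simp: K_def)
    then have "(t - a) * (h c1 g - h c2 g) \<le> (t - a) * K"
      using ab by (intro mult_left_mono) auto
    also have "\<dots> \<le> (e / (2 * K)) * K" using ab n K by (intro mult_right_mono) auto
    also have "\<dots> = e / 2" using K by simp
    finally show "t * h c1 g + (1 - t) * h c2 g - e \<le> h d g"
      using d(2)[rule_format, OF g] by (simp add: algebra_simps)
  qed
qed

text \<open>Separation in the plane: \<open>mix\<close> makes the image of \<open>G\<close> under
  \<open>(f1, f2)\<close> convex, \<open>alt\<close> keeps it off the open quadrant below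
  \<open>(c, c)\<close>, and \<open>(t, 1 - t)\<close> is the normal of a separating line. The
  weight is found by hand as a supremum of one-sided constraints, so the image may fail to be
  closed.\<close>

lemma two_function_alternative:
  fixes f1 f2 :: "'b \<Rightarrow> real"
  assumes mix: "\<And>g h t. g \<in> G \<Longrightarrow> h \<in> G \<Longrightarrow> 0 \<le> t \<Longrightarrow> t \<le> 1 \<Longrightarrow>
       \<exists>k\<in>G. f1 k = t * f1 g + (1 - t) * f1 h \<and> f2 k = t * f2 g + (1 - t) * f2 h"
    and alt: "\<And>g. g \<in> G \<Longrightarrow> c \<le> f1 g \<or> c \<le> f2 g"
  shows "\<exists>t. 0 \<le> t \<and> t \<le> 1 \<and> (\<forall>g\<in>G. c \<le> t * f1 g + (1 - t) * f2 g)"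
proof -
  define r where "r h = (c - f2 h) / ((f1 h - c) + (c - f2 h))" for h
  define L where "L = insert 0 (r ` {h\<in>G. f2 h < c})"
  define t where "t = Sup L"
  have h1: "c \<le> f1 h" if "h \<in> G" "f2 h < c" for h using alt that by force
  have L1: "x \<le> 1" if "x \<in> L" for x
    using that h1 unfolding L_def r_def by (auto simp: divide_simps)
  have bdd: "bdd_above L" using L1 by (auto intro!: bdd_aboveI)
  have t0: "0 \<le> t" unfolding t_def by (rule cSup_upper[OF _ bdd]) (simp add: L_def)
  have t1: "t \<le> 1" unfolding t_def by (rule cSup_least) (auto simp: L_def intro!: L1)
  have "c \<le> t * f1 g + (1 - t) * f2 g" if g: "g \<in> G" for g
  proof -
    consider "f2 g < c" | "f1 g < c" "c \<le> f2 g" | "c \<le> f1 g" "c \<le> f2 g" by linarith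
    then show ?thesis
    proof cases
      case 1
      then have f1: "c \<le> f1 g" using h1 g by auto
      have "r g \<le> t" unfolding t_def using 1 g by (intro cSup_upper[OF _ bdd]) (auto simp: L_def)
      then have "c - f2 g \<le> t * ((f1 g - c) + (c - f2 g))"
        using 1 f1 unfolding r_def by (simp add: divide_simps)
      then show ?thesis by (simp add: algebra_simps)
    next
      case 2
      \<comment> \<open>Where \<open>f1 g < c\<close> the constraint bounds \<open>t\<close> from
        above, so every lower constraint has to lie below every upper one.\<close>
      have "t \<le> (f2 g - c) / ((c - f1 g) + (f2 g - c))"
        unfolding t_def
      proof (rule cSup_least)
        show "L \<noteq> {}" by (simp add: L_def)
        fix x assume "x \<in> L"
        then consider "x = 0" | h where "h \<in> G" "f2 h < c" "x = r h" by (auto simp: L_def)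
        then show "x \<le> (f2 g - c) / ((c - f1 g) + (f2 g - c))"
        proof cases
          case 1 then show ?thesis using 2 by simp
        next
          case (2 h)
          define a b a' b' where "a = c - f1 g" and "b = f2 g - c" and "a' = f1 h - c" and "b' = c - f2 h"
          have pos: "0 < a" "0 \<le> b" "0 \<le> a'" "0 < b'"
            using \<open>f1 g < c\<close> \<open>c \<le> f2 g\<close> 2 h1[of h] by (auto simp: a_def b_def a'_def b'_def)
          have "b' * a \<le> b * a'"
          proof (rule ccontr)
            assume less: "\<not> b' * a \<le> b * a'"
            define S where "S = a' + b' + a + b"
            have S: "0 < S" using pos by (simp add: S_def)
            \<comment> \<open>The segment joining the images of \<open>g\<close> and
              \<open>h\<close> crosses the diagonal through \<open>(c, c)\<close> at this weight, so
              one number gives both \<open>f1 k - c\<close> and \<open>f2 k - c\<close>; it is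
              negative if the two constraints conflict.\<close>
            define s where "s = (a' + b') / S"
            have s: "0 \<le> s" "s \<le> 1" using pos S by (auto simp: s_def S_def)
            have s': "1 - s = (a + b) / S" using S by (simp add: s_def S_def field_simps)
            obtain k where k: "k \<in> G" "f1 k = s * f1 g + (1 - s) * f1 h" "f2 k = s * f2 g + (1 - s) * f2 h"
              using mix[OF g \<open>h \<in> G\<close> s] by blast
            have "f1 k - c = (1 - s) * a' - s * a"
              by (simp add: k a_def a'_def algebra_simps)
            also have "\<dots> = (b * a' - b' * a) / S"
              unfolding s' unfolding s_def by (simp add: diff_divide_distrib[symmetric] algebra_simps)
            also have "\<dots> < 0" using less S by (simp add: divide_neg_pos)
            finally have "f1 k < c" by simp
            have "f2 k - c = s * b - (1 - s) * b'"
              by (simp add: k b_def b'_def algebra_simps)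
            also have "\<dots> = (b * a' - b' * a) / S"
              unfolding s' unfolding s_def by (simp add: diff_divide_distrib[symmetric] algebra_simps)
            also have "\<dots> < 0" using less S by (simp add: divide_neg_pos)
            finally have "f2 k < c" by simp
            with \<open>f1 k < c\<close> alt[OF k(1)] show False by simp
          qed
          then have "b' / (a' + b') \<le> b / (a + b)"
            using pos by (simp add: divide_simps algebra_simps)
          then show ?thesis by (simp add: 2 r_def a_def b_def a'_def b'_def)
        qed
      qed
      then have "t * ((c - f1 g) + (f2 g - c)) \<le> f2 g - c"
        using 2 by (simp add: divide_simps)
      then show ?thesis by (simp add: algebra_simps)
    next
      case 3
      then have "t * c + (1 - t) * c \<le> t * f1 g + (1 - t) * f2 g"
        using t0 t1 by (intro add_mono mult_left_mono) auto
      then show ?thesis by (simp add: algebra_simps)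
    qed
  qed
  with t0 t1 show ?thesis by blast
qed

text \<open>Induction on \<open>F\<close> for all \<open>G\<close>: the new function
  \<open>x\<close> already handles every \<open>g\<close> outside \<open>H\<close>, and
  \<open>H\<close> is again stable under mixing because \<open>h x\<close> is affine. The induction
  hypothesis gives one \<open>y\<close> for \<open>H\<close>, so \<open>x\<close> and
  \<open>y\<close> cover \<open>G\<close>; separation in the plane followed by near-concavity merges
  them.\<close>

lemma finite_minimax:
  fixes h :: "'c \<Rightarrow> 'b \<Rightarrow> real"
  assumes conc: "\<And>c1 c2 t e. c1 \<in> C \<Longrightarrow> c2 \<in> C \<Longrightarrow> 0 \<le> t \<Longrightarrow> t \<le> 1 \<Longrightarrow> 0 < e \<Longrightarrow>
        \<exists>c\<in>C. \<forall>g\<in>G. t * h c1 g + (1 - t) * h c2 g - e \<le> h c g"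
    and mix: "\<And>g1 g2 t. g1 \<in> G \<Longrightarrow> g2 \<in> G \<Longrightarrow> 0 \<le> t \<Longrightarrow> t \<le> 1 \<Longrightarrow>
        \<exists>g\<in>G. \<forall>c\<in>C. h c g = t * h c g1 + (1 - t) * h c g2"
    and F: "finite F" "F \<noteq> {}" "F \<subseteq> C"
    and cover: "\<And>g. g \<in> G \<Longrightarrow> \<exists>c\<in>F. k \<le> h c g"
    and e: "0 < e"
  shows "\<exists>c\<in>C. \<forall>g\<in>G. k - e \<le> h c g"
  using F conc mix cover e
proof (induction F arbitrary: G e rule: finite_ne_induct)
  case (singleton x)
  show ?case
  proof (intro bexI[of _ x] ballI)
    fix g assume "g \<in> G"
    then have "k \<le> h x g" using singleton.prems(4)[of g] by auto
    then show "k - e \<le> h x g" using \<open>0 < e\<close> by simp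
  qed (use singleton in auto)
next
  case (insert x F)
  have x: "x \<in> C" and FC: "F \<subseteq> C" using insert.prems(1) by auto
  have e2: "0 < e / 2" using \<open>0 < e\<close> by simp
  define H where "H = {g\<in>G. h x g < k}"
  have "\<exists>c\<in>C. \<forall>g\<in>H. k - e/2 \<le> h c g"
  proof (rule insert.IH[OF FC])
    fix c1 c2 and t d :: real assume "c1 \<in> C" "c2 \<in> C" "0 \<le> t" "t \<le> 1" "0 < d"
    from insert.prems(2)[OF this] show "\<exists>c\<in>C. \<forall>g\<in>H. t * h c1 g + (1 - t) * h c2 g - d \<le> h c g"
      by (auto simp: H_def)
  next
    fix g1 g2 and t :: real assume g: "g1 \<in> H" "g2 \<in> H" and t: "0 \<le> t" "t \<le> 1"
    obtain g where gg: "g \<in> G" "\<forall>c\<in>C. h c g = t * h c g1 + (1 - t) * h c g2"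
      using insert.prems(3)[of g1 g2 t] g t by (auto simp: H_def)
    have "h x g < k"
      using gg(2) x convex_bound_lt[of "h x g1" k "h x g2" t "1 - t"] g t by (simp add: H_def)
    then show "\<exists>g\<in>H. \<forall>c\<in>C. h c g = t * h c g1 + (1 - t) * h c g2"
      using gg by (auto simp: H_def)
  next
    fix g assume "g \<in> H"
    then show "\<exists>c\<in>F. k \<le> h c g"
      using insert.prems(4)[of g] by (auto simp: H_def)
  qed (use e2 in auto)
  then obtain y where y: "y \<in> C" "\<forall>g\<in>H. k - e/2 \<le> h y g" by blast
  have "\<exists>t. 0 \<le> t \<and> t \<le> 1 \<and> (\<forall>g\<in>G. k - e/2 \<le> t * h x g + (1 - t) * h y g)"
  proof (rule two_function_alternative)
    fix g1 g2 and t :: real assume "g1 \<in> G" "g2 \<in> G" "0 \<le> t" "t \<le> 1"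
    from insert.prems(3)[OF this]
    show "\<exists>g\<in>G. h x g = t * h x g1 + (1 - t) * h x g2 \<and> h y g = t * h y g1 + (1 - t) * h y g2"
      using x y(1) by auto
  next
    fix g assume "g \<in> G"
    then show "k - e/2 \<le> h x g \<or> k - e/2 \<le> h y g"
      using y(2) e2 by (cases "g \<in> H") (auto simp: H_def)
  qed
  then obtain t where t: "0 \<le> t" "t \<le> 1" "\<forall>g\<in>G. k - e/2 \<le> t * h x g + (1 - t) * h y g" by blast
  obtain z where z: "z \<in> C" "\<forall>g\<in>G. t * h x g + (1 - t) * h y g - e/2 \<le> h z g"
    using insert.prems(2)[OF x y(1) t(1,2) e2] by blast
  show ?case
  proof (intro bexI[OF _ z(1)] ballI)
    fix g assume "g \<in> G"
    then show "k - e \<le> h z g" using t(3) z(2) by fastforce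
  qed
qed

section \<open>Convex combinations of uniformly integrable sequences\<close>

text \<open>Dyadic convex combinations. Midpoints are all that the parallelogram law asks for, and
  induction over them transfers affine facts without coefficients.\<close>

inductive_set midpoint_hull :: "('a \<Rightarrow> real) set \<Rightarrow> ('a \<Rightarrow> real) set" for A where
  base: "f \<in> A \<Longrightarrow> f \<in> midpoint_hull A"
| midpoint: "f \<in> midpoint_hull A \<Longrightarrow> g \<in> midpoint_hull A \<Longrightarrow> (\<lambda>x. (f x + g x) / 2) \<in> midpoint_hull A"

lemma midpoint_hull_mono: "A \<subseteq> B \<Longrightarrow> f \<in> midpoint_hull A \<Longrightarrow> f \<in> midpoint_hull B"
  by (rotate_tac, induction rule: midpoint_hull.induct) (auto intro: midpoint_hull.intros)

text \<open>A tail combination uses only finitely many indices; the next combination can then be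
  taken from indices beyond all of them.\<close>

lemma midpoint_hull_finite_support:
  fixes x :: "nat \<Rightarrow> 'a \<Rightarrow> real"
  assumes "f \<in> midpoint_hull (x ` {n..})"
  shows "\<exists>m. f \<in> midpoint_hull (x ` {..<m})"
  using assms
proof (induction rule: midpoint_hull.induct)
  case (base f)
  then obtain k where "f = x k" by auto
  then show ?case by (intro exI[of _ "Suc k"]) (auto intro: midpoint_hull.base)
next
  case (midpoint f g)
  then obtain k l where kl: "f \<in> midpoint_hull (x ` {..<k})" "g \<in> midpoint_hull (x ` {..<l})" by blast
  have "x ` {..<k} \<subseteq> x ` {..<max k l}" "x ` {..<l} \<subseteq> x ` {..<max k l}" by auto
  with kl show ?case by (intro exI[of _ "max k l"] midpoint_hull.midpoint) (auto intro: midpoint_hull_mono)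
qed

lemma midpoint_hull_bounded:
  assumes "f \<in> midpoint_hull A"
    and "\<And>f. f \<in> A \<Longrightarrow> f \<in> borel_measurable M \<and> (\<forall>x\<in>space M. \<bar>f x\<bar> \<le> B)"
  shows "f \<in> borel_measurable M \<and> (\<forall>x\<in>space M. \<bar>f x\<bar> \<le> (B::real))"
  using assms
proof (induction rule: midpoint_hull.induct)
  case (midpoint f g)
  then have fg: "f \<in> borel_measurable M" "g \<in> borel_measurable M"
    "\<And>x. x \<in> space M \<Longrightarrow> \<bar>f x\<bar> \<le> B" "\<And>x. x \<in> space M \<Longrightarrow> \<bar>g x\<bar> \<le> B" by auto
  have "\<bar>(f x + g x) / 2\<bar> \<le> B" if "x \<in> space M" for x
    using fg(3,4)[OF that] by (simp add: abs_le_iff)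
  with fg show ?case by auto
qed auto

text \<open>The infimum \<open>I n\<close> of the squared L2 norm over the tail hulls increases with
  \<open>n\<close> and stays bounded. Where it is nearly at its supremum, two near-minimizers in the
  same hull have a midpoint whose norm cannot be much smaller, so by the parallelogram law they are
  close in L2.\<close>

lemma (in prob_space) midpoint_hulls_close_bounded:
  fixes x :: "nat \<Rightarrow> 'a \<Rightarrow> real"
  assumes x: "\<And>n. x n \<in> borel_measurable M" "\<And>n \<omega>. \<omega> \<in> space M \<Longrightarrow> \<bar>x n \<omega>\<bar> \<le> B"
    and d: "0 < d"
  shows "\<exists>n. \<exists>f\<in>midpoint_hull (x ` {..<n}). \<exists>g\<in>midpoint_hull (x ` {n..}). (\<integral>\<omega>. \<bar>f \<omega> - g \<omega>\<bar> \<partial>M) \<le> d"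
proof -
  let ?H = "\<lambda>n. midpoint_hull (x ` {n..})"
  define q where "q f = (\<integral>\<omega>. (f \<omega>)\<^sup>2 \<partial>M)" for f :: "'a \<Rightarrow> real"
  define I where "I n = (INF f\<in>?H n. q f)" for n
  have bd: "f \<in> borel_measurable M" "\<And>\<omega>. \<omega> \<in> space M \<Longrightarrow> \<bar>f \<omega>\<bar> \<le> B" if "f \<in> ?H n" for f n
    using midpoint_hull_bounded[OF that, of M B] x by auto
  have prod_int: "integrable M (\<lambda>\<omega>. f \<omega> * g \<omega>)" if "f \<in> ?H n" "g \<in> ?H m" for f g n m
  proof (rule integrable_const_bound[of _ "B * B"])
    show "AE \<omega> in M. norm (f \<omega> * g \<omega>) \<le> B * B"
      using bd[OF that(1)] bd[OF that(2)] by (auto simp: abs_mult intro!: AE_I2 mult_mono abs_ge_zero order_trans[OF abs_ge_zero])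
    show "(\<lambda>\<omega>. f \<omega> * g \<omega>) \<in> borel_measurable M" using bd(1)[OF that(1)] bd(1)[OF that(2)] by simp
  qed
  have q0: "0 \<le> q f" for f by (simp add: q_def)
  have qB: "q f \<le> B * B" if "f \<in> ?H n" for f n
    unfolding q_def power2_eq_square
  proof (rule integral_le_const[OF prod_int[OF that that]])
    show "AE \<omega> in M. f \<omega> * f \<omega> \<le> B * B"
      using bd(2)[OF that] by (intro AE_I2) (metis abs_ge_zero abs_mult_self_eq mult_mono order_trans)
  qed
  have ne: "?H n \<noteq> {}" for n using midpoint_hull.base[of "x n" "x ` {n..}"] by auto
  have bddq: "bdd_below (q ` ?H n)" for n using q0 by (intro bdd_belowI[of _ 0]) auto
  have I_le: "I n \<le> q f" if "f \<in> ?H n" for n f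
    unfolding I_def using that by (intro cINF_lower[OF bddq])
  have bddI: "bdd_above (range I)"
    using ne I_le qB by (intro bdd_aboveI[of _ "B * B"]) (metis all_not_in_conv imageE order_trans)
  define D where "D = (SUP n. I n)"
  have I_D: "I n \<le> D" for n unfolding D_def by (intro cSUP_upper bddI) auto
  \<comment> \<open>The parallelogram law bounds the squared distance by
    \<open>4 * (D + eta) - 4 * (D - eta) = 8 * eta\<close>, which is to be
    \<open>d\<^sup>2\<close>.\<close>
  define eta where "eta = d\<^sup>2 / 8"
  have eta: "0 < eta" using d by (simp add: eta_def)
  have "D - eta < (SUP n. I n)" using eta by (simp add: D_def)
  then obtain n where n: "D - eta < I n"
    using less_cSUP_iff[OF _ bddI] by auto
  have near: "\<exists>f\<in>?H m. q f < D + eta" for m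
  proof -
    have "I m < D + eta" using I_D[of m] eta by linarith
    then show ?thesis unfolding I_def using cINF_less_iff[OF ne bddq] by blast
  qed
  obtain f where f: "f \<in> ?H n" "q f < D + eta" using near by blast
  obtain m0 where m0: "f \<in> midpoint_hull (x ` {..<m0})"
    using midpoint_hull_finite_support[OF f(1)] by blast
  \<comment> \<open>Past both \<open>m0\<close> and \<open>n\<close>: \<open>f\<close> then lies in
    the hull of the initial segment, while \<open>g\<close> comes from the \<open>m\<close>-tail and
    still belongs to \<open>?H n\<close>.\<close>
  define m where "m = max m0 n"
  have fm: "f \<in> midpoint_hull (x ` {..<m})"
    by (rule midpoint_hull_mono[OF _ m0]) (auto simp: m_def)
  obtain g where g: "g \<in> ?H m" "q g < D + eta" using near by blast
  have gn: "g \<in> ?H n" by (rule midpoint_hull_mono[OF _ g(1)]) (auto simp: m_def)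
  have "D - eta < q (\<lambda>\<omega>. (f \<omega> + g \<omega>) / 2)"
    using n I_le[OF midpoint_hull.midpoint[OF f(1) gn]] by linarith
  moreover have "q (\<lambda>\<omega>. (f \<omega> + g \<omega>) / 2) = (q f + q g) / 4 + (\<integral>\<omega>. f \<omega> * g \<omega> \<partial>M) / 2"
  proof -
    have "q (\<lambda>\<omega>. (f \<omega> + g \<omega>) / 2) = (\<integral>\<omega>. (f \<omega> * f \<omega> + g \<omega> * g \<omega>) / 4 + (f \<omega> * g \<omega>) / 2 \<partial>M)"
      unfolding q_def by (intro Bochner_Integration.integral_cong) (auto simp: power2_eq_square field_simps)
    also have "\<dots> = (q f + q g) / 4 + (\<integral>\<omega>. f \<omega> * g \<omega> \<partial>M) / 2"
      using prod_int[OF f(1) f(1)] prod_int[OF gn gn] prod_int[OF f(1) gn]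
      by (simp add: q_def power2_eq_square)
    finally show ?thesis .
  qed
  moreover have sq: "(\<integral>\<omega>. (f \<omega> - g \<omega>)\<^sup>2 \<partial>M) = q f + q g - 2 * (\<integral>\<omega>. f \<omega> * g \<omega> \<partial>M)"
  proof -
    have "(\<integral>\<omega>. (f \<omega> - g \<omega>)\<^sup>2 \<partial>M) = (\<integral>\<omega>. f \<omega> * f \<omega> + g \<omega> * g \<omega> - 2 * (f \<omega> * g \<omega>) \<partial>M)"
      by (intro Bochner_Integration.integral_cong) (auto simp: power2_eq_square field_simps)
    also have "\<dots> = q f + q g - 2 * (\<integral>\<omega>. f \<omega> * g \<omega> \<partial>M)"
      using prod_int[OF f(1) f(1)] prod_int[OF gn gn] prod_int[OF f(1) gn]
      by (simp add: q_def power2_eq_square)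
    finally show ?thesis .
  qed
  ultimately have small: "(\<integral>\<omega>. (f \<omega> - g \<omega>)\<^sup>2 \<partial>M) \<le> d\<^sup>2"
    using f(2) g(2) unfolding eta_def by argo
  have int_sq: "integrable M (\<lambda>\<omega>. (f \<omega> - g \<omega>)\<^sup>2)"
    unfolding power2_eq_square left_diff_distrib right_diff_distrib
    by (intro Bochner_Integration.integrable_diff prod_int[OF f(1) f(1)] prod_int[OF gn gn]
        prod_int[OF f(1) gn] prod_int[OF gn f(1)])
  \<comment> \<open>The pointwise bound obtained from a nonnegative square takes the place of the
    Cauchy-Schwarz inequality.\<close>
  have "(\<integral>\<omega>. \<bar>f \<omega> - g \<omega>\<bar> \<partial>M) \<le> (\<integral>\<omega>. (f \<omega> - g \<omega>)\<^sup>2 / (2 * d) + d / 2 \<partial>M)"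
  proof (rule integral_mono)
    show "integrable M (\<lambda>\<omega>. \<bar>f \<omega> - g \<omega>\<bar>)"
    proof (rule integrable_const_bound[of _ "2 * B"])
      show "AE \<omega> in M. norm \<bar>f \<omega> - g \<omega>\<bar> \<le> 2 * B"
        using bd(2)[OF f(1)] bd(2)[OF gn] by (intro AE_I2) (smt (verit) real_norm_def)
      show "(\<lambda>\<omega>. \<bar>f \<omega> - g \<omega>\<bar>) \<in> borel_measurable M" using bd(1)[OF f(1)] bd(1)[OF gn] by simp
    qed
    show "integrable M (\<lambda>\<omega>. (f \<omega> - g \<omega>)\<^sup>2 / (2 * d) + d / 2)" using int_sq by simp
    fix \<omega>
    have "0 \<le> (\<bar>f \<omega> - g \<omega>\<bar> - d)\<^sup>2" by simp
    then have "2 * d * \<bar>f \<omega> - g \<omega>\<bar> \<le> (f \<omega> - g \<omega>)\<^sup>2 + d * d"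
      by (simp add: power2_diff power2_eq_square algebra_simps)
    then show "\<bar>f \<omega> - g \<omega>\<bar> \<le> (f \<omega> - g \<omega>)\<^sup>2 / (2 * d) + d / 2"
      using d by (simp add: field_simps)
  qed
  also have "\<dots> = (\<integral>\<omega>. (f \<omega> - g \<omega>)\<^sup>2 \<partial>M) / (2 * d) + d / 2"
    using int_sq by (simp add: prob_space)
  also have "\<dots> \<le> d\<^sup>2 / (2 * d) + d / 2" using small d by (intro add_right_mono divide_right_mono) auto
  also have "\<dots> = d" using d by (simp add: power2_eq_square)
  finally show ?thesis using fm g(1) by blast
qed

text \<open>Truncation at a level \<open>N\<close> moves every \<open>g n\<close> by at most
  \<open>d / 3\<close> in L1, uniformly in \<open>n\<close>, and reduces to the bounded case; the
  remaining third is the distance between the truncated combinations.\<close>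

lemma (in prob_space) midpoint_hulls_close:
  fixes g :: "nat \<Rightarrow> 'a \<Rightarrow> real"
  assumes g: "\<And>n. integrable M (g n)" "\<And>n \<omega>. \<omega> \<in> space M \<Longrightarrow> 0 \<le> g n \<omega>"
    and UI: "\<And>d. 0 < d \<Longrightarrow> \<exists>N. \<forall>n. (\<integral>\<omega>. max (g n \<omega> - N) 0 \<partial>M) \<le> d"
    and d: "0 < d"
  shows "\<exists>n. \<exists>f\<in>midpoint_hull (g ` {..<n}). \<exists>f'\<in>midpoint_hull (g ` {n..}). (\<integral>\<omega>. \<bar>f \<omega> - f' \<omega>\<bar> \<partial>M) \<le> d"
proof -
  have d3: "0 < d / 3" using d by simp
  obtain N0 where N0: "\<And>n. (\<integral>\<omega>. max (g n \<omega> - N0) 0 \<partial>M) \<le> d / 3"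
    using UI[OF d3] by blast
  \<comment> \<open>\<open>N0\<close> may be negative; raising the level to at least 0 only shrinks
    the tails and makes \<open>N\<close> a bound for the absolute value of the truncation.\<close>
  define N where "N = max N0 0"
  have tail: "(\<integral>\<omega>. max (g n \<omega> - N) 0 \<partial>M) \<le> d / 3" for n
  proof -
    have "(\<integral>\<omega>. max (g n \<omega> - N) 0 \<partial>M) \<le> (\<integral>\<omega>. max (g n \<omega> - N0) 0 \<partial>M)"
      using g(1)[of n] by (intro integral_mono Bochner_Integration.integrable_max) (auto simp: N_def)
    then show ?thesis using N0[of n] by linarith
  qed
  define x where "x n \<omega> = min (g n \<omega>) N" for n \<omega>
  have x_meas: "x n \<in> borel_measurable M" for n
    using g(1)[of n] unfolding x_def by measurable
  have x_bd: "\<bar>x n \<omega>\<bar> \<le> N" if "\<omega> \<in> space M" for n \<omega>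
    using g(2)[OF that, of n] by (auto simp: x_def N_def)
  \<comment> \<open>Truncation does not commute with midpoints, so the untruncated partner of a
    combination is built along the same tree of midpoints.\<close>
  have approx: "\<exists>f'\<in>midpoint_hull (g ` J). integrable M f' \<and> f \<in> borel_measurable M \<and>
      (\<forall>\<omega>\<in>space M. \<bar>f \<omega>\<bar> \<le> N) \<and> (\<integral>\<omega>. \<bar>f' \<omega> - f \<omega>\<bar> \<partial>M) \<le> d / 3"
    if "f \<in> midpoint_hull (x ` J)" for f J
    using that
  proof (induction rule: midpoint_hull.induct)
    case (base f)
    then obtain n where n: "n \<in> J" "f = x n" by blast
    have "(\<integral>\<omega>. \<bar>g n \<omega> - x n \<omega>\<bar> \<partial>M) = (\<integral>\<omega>. max (g n \<omega> - N) 0 \<partial>M)"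
      by (intro Bochner_Integration.integral_cong) (auto simp: x_def)
    then show ?case
      using n g(1)[of n] x_meas[of n] x_bd[of _ n] tail[of n]
      by (intro bexI[of _ "g n"]) (auto intro: midpoint_hull.base)
  next
    case (midpoint f1 f2)
    obtain h1 where h1: "h1 \<in> midpoint_hull (g ` J)" "integrable M h1" "f1 \<in> borel_measurable M"
      "\<forall>\<omega>\<in>space M. \<bar>f1 \<omega>\<bar> \<le> N" "(\<integral>\<omega>. \<bar>h1 \<omega> - f1 \<omega>\<bar> \<partial>M) \<le> d / 3"
      using midpoint.IH(1) by blast
    obtain h2 where h2: "h2 \<in> midpoint_hull (g ` J)" "integrable M h2" "f2 \<in> borel_measurable M"
      "\<forall>\<omega>\<in>space M. \<bar>f2 \<omega>\<bar> \<le> N" "(\<integral>\<omega>. \<bar>h2 \<omega> - f2 \<omega>\<bar> \<partial>M) \<le> d / 3"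
      using midpoint.IH(2) by blast
    have i: "integrable M f1" "integrable M f2"
      using h1 h2 by (auto intro!: integrable_const_bound[of _ N] AE_I2)
    have "(\<integral>\<omega>. \<bar>(h1 \<omega> + h2 \<omega>) / 2 - (f1 \<omega> + f2 \<omega>) / 2\<bar> \<partial>M)
        \<le> (\<integral>\<omega>. \<bar>h1 \<omega> - f1 \<omega>\<bar> / 2 + \<bar>h2 \<omega> - f2 \<omega>\<bar> / 2 \<partial>M)"
    proof (rule integral_mono)
      fix \<omega>
      have "(h1 \<omega> + h2 \<omega>) / 2 - (f1 \<omega> + f2 \<omega>) / 2 = (h1 \<omega> - f1 \<omega>) / 2 + (h2 \<omega> - f2 \<omega>) / 2"
        by (simp add: field_simps)
      then show "\<bar>(h1 \<omega> + h2 \<omega>) / 2 - (f1 \<omega> + f2 \<omega>) / 2\<bar> \<le> \<bar>h1 \<omega> - f1 \<omega>\<bar> / 2 + \<bar>h2 \<omega> - f2 \<omega>\<bar> / 2"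
        using abs_triangle_ineq[of "(h1 \<omega> - f1 \<omega>) / 2" "(h2 \<omega> - f2 \<omega>) / 2"] by simp
    qed (use i h1(2) h2(2) in auto)
    also have "\<dots> = (\<integral>\<omega>. \<bar>h1 \<omega> - f1 \<omega>\<bar> \<partial>M) / 2 + (\<integral>\<omega>. \<bar>h2 \<omega> - f2 \<omega>\<bar> \<partial>M) / 2"
      using i h1(2) h2(2) by simp
    also have "\<dots> \<le> d / 3" using h1(5) h2(5) by simp
    finally have close: "(\<integral>\<omega>. \<bar>(h1 \<omega> + h2 \<omega>) / 2 - (f1 \<omega> + f2 \<omega>) / 2\<bar> \<partial>M) \<le> d / 3" .
    have bound: "\<bar>(f1 \<omega> + f2 \<omega>) / 2\<bar> \<le> N" if "\<omega> \<in> space M" for \<omega>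
      using h1(4)[rule_format, OF that] h2(4)[rule_format, OF that] by (simp add: abs_le_iff)
    show ?case
      using h1(1-3) h2(1-3) close bound
      by (intro bexI[OF _ midpoint_hull.midpoint[OF h1(1) h2(1)]]) auto
  qed
  have "\<exists>n. \<exists>f\<in>midpoint_hull (x ` {..<n}). \<exists>f'\<in>midpoint_hull (x ` {n..}). (\<integral>\<omega>. \<bar>f \<omega> - f' \<omega>\<bar> \<partial>M) \<le> d / 3"
    by (rule midpoint_hulls_close_bounded[OF x_meas x_bd d3])
  then obtain n f f' where ff': "f \<in> midpoint_hull (x ` {..<n})" "f' \<in> midpoint_hull (x ` {n..})"
      "(\<integral>\<omega>. \<bar>f \<omega> - f' \<omega>\<bar> \<partial>M) \<le> d / 3"
    by blast
  obtain h where h: "h \<in> midpoint_hull (g ` {..<n})" "integrable M h" "f \<in> borel_measurable M"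
      "\<forall>\<omega>\<in>space M. \<bar>f \<omega>\<bar> \<le> N" "(\<integral>\<omega>. \<bar>h \<omega> - f \<omega>\<bar> \<partial>M) \<le> d / 3"
    using approx[OF ff'(1)] by blast
  obtain h' where h': "h' \<in> midpoint_hull (g ` {n..})" "integrable M h'" "f' \<in> borel_measurable M"
      "\<forall>\<omega>\<in>space M. \<bar>f' \<omega>\<bar> \<le> N" "(\<integral>\<omega>. \<bar>h' \<omega> - f' \<omega>\<bar> \<partial>M) \<le> d / 3"
    using approx[OF ff'(2)] by blast
  have i: "integrable M f" "integrable M f'"
    using h h' by (auto intro!: integrable_const_bound[of _ N] AE_I2)
  have "(\<integral>\<omega>. \<bar>h \<omega> - h' \<omega>\<bar> \<partial>M)
      \<le> (\<integral>\<omega>. \<bar>h \<omega> - f \<omega>\<bar> + \<bar>f \<omega> - f' \<omega>\<bar> + \<bar>h' \<omega> - f' \<omega>\<bar> \<partial>M)"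
    using i h(2) h'(2) by (intro integral_mono) auto
  also have "\<dots> = (\<integral>\<omega>. \<bar>h \<omega> - f \<omega>\<bar> \<partial>M) + (\<integral>\<omega>. \<bar>f \<omega> - f' \<omega>\<bar> \<partial>M) + (\<integral>\<omega>. \<bar>h' \<omega> - f' \<omega>\<bar> \<partial>M)"
    using i h(2) h'(2) by simp
  also have "\<dots> \<le> d" using ff'(3) h(5) h'(5) by simp
  finally show ?thesis using h(1) h'(1) by blast
qed

section \<open>Minimax over a uniformly integrable set\<close>

text \<open>Rounding the values \<open>h c g / e\<close> down to integers leaves finitely many
  profiles on \<open>A\<close>, by boundedness; one representative per profile is a net.\<close>

lemma finite_net_of_functionals:
  fixes h :: "'c \<Rightarrow> 'b \<Rightarrow> real"
  assumes A: "finite A" and bound: "\<And>c g. c \<in> C \<Longrightarrow> g \<in> A \<Longrightarrow> \<bar>h c g\<bar> \<le> B" and e: "0 < e"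
  shows "\<exists>F\<subseteq>C. finite F \<and> (\<forall>c\<in>C. \<exists>c'\<in>F. \<forall>g\<in>A. \<bar>h c g - h c' g\<bar> \<le> e)"
proof -
  define p where "p c = restrict (\<lambda>g. \<lfloor>h c g / e\<rfloor>) A" for c
  have "p ` C \<subseteq> (\<Pi>\<^sub>E g\<in>A. {\<lfloor>- B / e\<rfloor>..\<lfloor>B / e\<rfloor>})"
  proof (rule image_subsetI)
    fix c assume c: "c \<in> C"
    have "\<lfloor>h c g / e\<rfloor> \<in> {\<lfloor>- B / e\<rfloor>..\<lfloor>B / e\<rfloor>}" if g: "g \<in> A" for g
    proof -
      have "- B / e \<le> h c g / e" "h c g / e \<le> B / e"
        using bound[OF c g] e divide_right_mono[of "- B" "h c g" e] by (auto intro: divide_right_mono)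
      then show ?thesis by (auto intro: floor_mono)
    qed
    then show "p c \<in> (\<Pi>\<^sub>E g\<in>A. {\<lfloor>- B / e\<rfloor>..\<lfloor>B / e\<rfloor>})" by (auto simp: p_def)
  qed
  then have "finite (p ` C)" by (rule finite_subset) (intro finite_PiE A finite_atLeastAtMost_int)
  then obtain F where F: "F \<subseteq> C" "finite F" "p ` C = p ` F"
    using finite_subset_image[of "p ` C" p C] by blast
  have "\<exists>c'\<in>F. \<forall>g\<in>A. \<bar>h c g - h c' g\<bar> \<le> e" if c: "c \<in> C" for c
  proof -
    obtain c' where c': "c' \<in> F" "p c = p c'" using F c by blast
    have "\<bar>h c g - h c' g\<bar> \<le> e" if g: "g \<in> A" for g
    proof -
      have "\<lfloor>h c g / e\<rfloor> = \<lfloor>h c' g / e\<rfloor>"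
        using fun_cong[OF c'(2), of g] g by (simp add: p_def)
      then have "\<bar>h c g / e - h c' g / e\<bar> \<le> 1" by linarith
      then show ?thesis using e by (simp add: abs_le_iff diff_divide_distrib[symmetric] field_simps)
    qed
    with c' show ?thesis by blast
  qed
  with F show ?thesis by blast
qed

text \<open>\<open>V\<close> and \<open>W\<close> enter only through epsilon statements, so that
  \<open>C\<close> can be a convenient subfamily of stopping times while \<open>V\<close> and
  \<open>W\<close> are the values of the full problem.\<close>

lemma (in prob_space) minimax_uniformly_integrable:
  fixes G :: "('a \<Rightarrow> real) set" and X :: "'c \<Rightarrow> 'a \<Rightarrow> real"
  assumes int: "\<And>g. g \<in> G \<Longrightarrow> integrable M g" and nonneg: "\<And>g \<omega>. g \<in> G \<Longrightarrow> \<omega> \<in> space M \<Longrightarrow> 0 \<le> g \<omega>"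
    and mixG: "\<And>g g' t. g \<in> G \<Longrightarrow> g' \<in> G \<Longrightarrow> 0 \<le> t \<Longrightarrow> t \<le> 1 \<Longrightarrow> (\<lambda>\<omega>. t * g \<omega> + (1 - t) * g' \<omega>) \<in> G"
    and UI: "\<And>d. 0 < d \<Longrightarrow> \<exists>N. \<forall>g\<in>G. (\<integral>\<omega>. max (g \<omega> - N) 0 \<partial>M) \<le> d"
    and X: "\<And>c. c \<in> C \<Longrightarrow> X c \<in> borel_measurable M" "\<And>c \<omega>. c \<in> C \<Longrightarrow> \<omega> \<in> space M \<Longrightarrow> \<bar>X c \<omega>\<bar> \<le> 1"
    and lam: "0 < lam" "lam < 1"
    and conc: "\<And>c1 c2 e. c1 \<in> C \<Longrightarrow> c2 \<in> C \<Longrightarrow> 0 < e \<Longrightarrow>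
        \<exists>c\<in>C. \<forall>g\<in>G. lam * (\<integral>\<omega>. g \<omega> * X c1 \<omega> \<partial>M) + (1 - lam) * (\<integral>\<omega>. g \<omega> * X c2 \<omega> \<partial>M) - e \<le> (\<integral>\<omega>. g \<omega> * X c \<omega> \<partial>M)"
    and lower: "\<And>c e. c \<in> C \<Longrightarrow> 0 < e \<Longrightarrow> \<exists>g\<in>G. (\<integral>\<omega>. g \<omega> * X c \<omega> \<partial>M) < V + e"
    and upper: "\<And>g e. g \<in> G \<Longrightarrow> 0 < e \<Longrightarrow> \<exists>c\<in>C. W - e < (\<integral>\<omega>. g \<omega> * X c \<omega> \<partial>M)"
    and ne: "G \<noteq> {}"
  shows "W \<le> V"
proof -
  define h where "h c g = (\<integral>\<omega>. g \<omega> * X c \<omega> \<partial>M)" for c g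
  have int_gX: "integrable M (\<lambda>\<omega>. g \<omega> * X c \<omega>)" if "integrable M g" "c \<in> C" for g c
  proof (rule Bochner_Integration.integrable_bound[OF that(1)])
    show "AE \<omega> in M. norm (g \<omega> * X c \<omega>) \<le> norm (g \<omega>)"
      using X(2)[OF that(2)] by (intro AE_I2) (auto simp: abs_mult intro: mult_left_le)
    show "(\<lambda>\<omega>. g \<omega> * X c \<omega>) \<in> borel_measurable M" using that X by simp
  qed
  \<comment> \<open>Uniform integrability at \<open>d = 1\<close> already bounds the L1 norms, hence
    all payoffs.\<close>
  obtain N where N: "\<And>g. g \<in> G \<Longrightarrow> (\<integral>\<omega>. max (g \<omega> - N) 0 \<partial>M) \<le> 1" using UI[of 1] by auto
  have L1: "(\<integral>\<omega>. g \<omega> \<partial>M) \<le> N + 1" if g: "g \<in> G" for g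
  proof -
    have "(\<integral>\<omega>. g \<omega> \<partial>M) \<le> (\<integral>\<omega>. max (g \<omega> - N) 0 + N \<partial>M)"
      using int[OF g] by (intro integral_mono Bochner_Integration.integrable_add Bochner_Integration.integrable_max) auto
    also have "\<dots> = (\<integral>\<omega>. max (g \<omega> - N) 0 \<partial>M) + N"
      using int[OF g] by (simp add: prob_space)
    also have "\<dots> \<le> N + 1" using N[OF g] by simp
    finally show ?thesis .
  qed
  have h_bound: "\<bar>h c g\<bar> \<le> N + 1" if c: "c \<in> C" and g: "g \<in> G" for c g
  proof -
    have "\<bar>h c g\<bar> \<le> (\<integral>\<omega>. \<bar>g \<omega> * X c \<omega>\<bar> \<partial>M)" unfolding h_def by (rule integral_abs_bound)
    also have "\<dots> \<le> (\<integral>\<omega>. g \<omega> \<partial>M)"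
    proof (rule integral_mono)
      show "integrable M (\<lambda>\<omega>. \<bar>g \<omega> * X c \<omega>\<bar>)"
        using int_gX[OF int[OF g] c] by (rule integrable_abs)
      show "\<bar>g \<omega> * X c \<omega>\<bar> \<le> g \<omega>" if "\<omega> \<in> space M" for \<omega>
        using nonneg[OF g that] X(2)[OF c that] by (simp add: abs_mult mult_left_le)
    qed (rule int[OF g])
    finally show ?thesis using L1[OF g] by linarith
  qed
  have h_mix: "h c (\<lambda>\<omega>. t * g \<omega> + (1 - t) * g' \<omega>) = t * h c g + (1 - t) * h c g'"
    if "c \<in> C" "integrable M g" "integrable M g'" for c t g g'
  proof -
    have "h c (\<lambda>\<omega>. t * g \<omega> + (1 - t) * g' \<omega>) = (\<integral>\<omega>. t * (g \<omega> * X c \<omega>) + (1 - t) * (g' \<omega> * X c \<omega>) \<partial>M)"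
      unfolding h_def by (intro Bochner_Integration.integral_cong) (auto simp: algebra_simps)
    also have "\<dots> = t * h c g + (1 - t) * h c g'"
      unfolding h_def using int_gX[OF that(2,1)] int_gX[OF that(3,1)] by simp
    finally show ?thesis .
  qed
  have conc_h: "\<exists>c\<in>C. \<forall>g\<in>G. t * h c1 g + (1 - t) * h c2 g - e \<le> h c g"
    if "c1 \<in> C" "c2 \<in> C" "0 \<le> t" "t \<le> 1" "0 < e" for c1 c2 t e
    by (rule approx_concave_all_weights[OF lam h_bound _ that(3,4,1,2,5)])
      (use conc in \<open>auto simp: h_def\<close>)
  have mix_h: "\<exists>g\<in>G. \<forall>c\<in>C. h c g = t * h c g1 + (1 - t) * h c g2"
    if "g1 \<in> G" "g2 \<in> G" "0 \<le> t" "t \<le> 1" for g1 g2 t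
    using mixG[OF that] h_mix that int by blast
  \<comment> \<open>Contrapositive of the finite minimax: if every \<open>g\<close> gave more than
    \<open>V + e\<close> against some member of \<open>F\<close>, a single \<open>c\<close> would
    secure \<open>V + e / 2\<close> against all \<open>g\<close>, contradicting
    \<open>lower\<close>.\<close>
  have pick: "\<exists>g\<in>G. \<forall>c\<in>F. h c g \<le> V + e" if F: "finite F" "F \<subseteq> C" and e: "0 < e" for F e
  proof (cases "F = {}")
    case True
    then show ?thesis using ne by auto
  next
    case False
    show ?thesis
    proof (rule ccontr)
      assume "\<not> ?thesis"
      then have cover: "\<exists>c\<in>F. V + e \<le> h c g" if "g \<in> G" for g using that by (meson linear)
      have "\<exists>c\<in>C. \<forall>g\<in>G. (V + e) - e / 2 \<le> h c g"
        by (rule finite_minimax[OF conc_h mix_h F(1) False F(2) cover]) (use e in auto)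
      then obtain c where c: "c \<in> C" "\<And>g. g \<in> G \<Longrightarrow> V + e / 2 \<le> h c g" by fastforce
      have "0 < e / 2" using e by simp
      from lower[OF c(1) this] c(2) show False unfolding h_def by fastforce
    qed
  qed
  \<comment> \<open>Four errors of size \<open>e\<close>: \<open>c\<close> is nearly optimal for
    \<open>f\<close>, a net point \<open>c'\<close> imitates \<open>c\<close> on \<open>f\<close>,
    \<open>f'\<close> is L1-close to \<open>f\<close>, and \<open>f'\<close> is nearly minimal
    against \<open>c'\<close>.\<close>
  have bound: "W \<le> V + 4 * e" if e: "0 < e" for e
  proof -
    \<comment> \<open>A choice function on sets, so that the recursion below can name the net of the
      terms built so far.\<close>
    define net where "net A = (SOME F. F \<subseteq> C \<and> finite F \<and> (\<forall>c\<in>C. \<exists>c'\<in>F. \<forall>g\<in>A. \<bar>h c g - h c' g\<bar> \<le> e))"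
      for A :: "('a \<Rightarrow> real) set"
    have net: "net A \<subseteq> C" "finite (net A)" "\<And>c. c \<in> C \<Longrightarrow> \<exists>c'\<in>net A. \<forall>g\<in>A. \<bar>h c g - h c' g\<bar> \<le> e"
      if "finite A" "A \<subseteq> G" for A
    proof -
      have "\<exists>F. F \<subseteq> C \<and> finite F \<and> (\<forall>c\<in>C. \<exists>c'\<in>F. \<forall>g\<in>A. \<bar>h c g - h c' g\<bar> \<le> e)"
        using finite_net_of_functionals[OF that(1), of C h "N + 1" e] h_bound that(2) e by blast
      from someI_ex[OF this]
      show "net A \<subseteq> C" "finite (net A)" "\<And>c. c \<in> C \<Longrightarrow> \<exists>c'\<in>net A. \<forall>g\<in>A. \<bar>h c g - h c' g\<bar> \<le> e"
        unfolding net_def by blast+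
    qed
    \<comment> \<open>Every \<open>g n\<close> is tested against the nets of all its initial
      segments, not only the latest; this makes the whole tail from \<open>n\<close> on nearly
      minimal for the net of the first \<open>n\<close> terms.\<close>
    have "\<exists>g :: nat \<Rightarrow> 'a \<Rightarrow> real. \<forall>n. g n \<in> G \<and> (\<forall>k\<le>n. \<forall>c\<in>net (g ` {..<k}). h c (g n) \<le> V + e)"
    proof (rule dependent_wellorder_choice)
      fix r and f f' :: "nat \<Rightarrow> 'a \<Rightarrow> real" and n
      assume eq: "\<And>m. m < n \<Longrightarrow> f m = f' m"
      have "f ` {..<k} = f' ` {..<k}" if "k \<le> n" for k
        using eq that by (intro image_cong) auto
      then show "(r \<in> G \<and> (\<forall>k\<le>n. \<forall>c\<in>net (f ` {..<k}). h c r \<le> V + e)) =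
          (r \<in> G \<and> (\<forall>k\<le>n. \<forall>c\<in>net (f' ` {..<k}). h c r \<le> V + e))" by auto
    next
      fix n and f :: "nat \<Rightarrow> 'a \<Rightarrow> real"
      assume "\<And>m. m < n \<Longrightarrow> f m \<in> G \<and> (\<forall>k\<le>m. \<forall>c\<in>net (f ` {..<k}). h c (f m) \<le> V + e)"
      then have "f ` {..<k} \<subseteq> G" if "k \<le> n" for k using that by auto
      then have "finite (net (f ` {..<k}))" "net (f ` {..<k}) \<subseteq> C" if "k \<le> n" for k
        using net(1,2)[of "f ` {..<k}"] that by auto
      then have "finite (\<Union>k\<le>n. net (f ` {..<k}))" "(\<Union>k\<le>n. net (f ` {..<k})) \<subseteq> C"
        by (intro finite_UN_I finite_atMost UN_least; simp)+
      from pick[OF this e] show "\<exists>r. r \<in> G \<and> (\<forall>k\<le>n. \<forall>c\<in>net (f ` {..<k}). h c r \<le> V + e)" by blast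
    qed
    then obtain g :: "nat \<Rightarrow> 'a \<Rightarrow> real"
      where step: "\<forall>n. g n \<in> G \<and> (\<forall>k\<le>n. \<forall>c\<in>net (g ` {..<k}). h c (g n) \<le> V + e)" ..
    have g: "g n \<in> G" "k \<le> n \<Longrightarrow> c \<in> net (g ` {..<k}) \<Longrightarrow> h c (g n) \<le> V + e" for n k c
      using step by auto
    have "\<exists>n. \<exists>f\<in>midpoint_hull (g ` {..<n}). \<exists>f'\<in>midpoint_hull (g ` {n..}). (\<integral>\<omega>. \<bar>f \<omega> - f' \<omega>\<bar> \<partial>M) \<le> e"
    proof (rule midpoint_hulls_close)
      fix d :: real assume "0 < d"
      from UI[OF this] show "\<exists>N. \<forall>n. (\<integral>\<omega>. max (g n \<omega> - N) 0 \<partial>M) \<le> d" using g(1) by blast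
    qed (use g int nonneg e in auto)
    then obtain n f f' where f: "f \<in> midpoint_hull (g ` {..<n})" and f': "f' \<in> midpoint_hull (g ` {n..})"
      and close: "(\<integral>\<omega>. \<bar>f \<omega> - f' \<omega>\<bar> \<partial>M) \<le> e" by blast
    have hull_G: "u \<in> G" if "u \<in> midpoint_hull (g ` J)" for u J
      using that
    proof (induction rule: midpoint_hull.induct)
      case (midpoint u v)
      then show ?case using mixG[of u v "1/2"] by (simp add: add_divide_distrib)
    qed (use g in auto)
    have h_mid: "h c (\<lambda>\<omega>. (u \<omega> + v \<omega>) / 2) = (h c u + h c v) / 2" if "c \<in> C" "u \<in> G" "v \<in> G" for c u v
      using h_mix[OF that(1) int[OF that(2)] int[OF that(3)], of "1/2"] by (simp add: add_divide_distrib)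
    obtain c where c: "c \<in> C" "W - e < h c f"
      using upper[OF hull_G[OF f] e] unfolding h_def by blast
    obtain c' where c': "c' \<in> net (g ` {..<n})" "\<And>k. k < n \<Longrightarrow> \<bar>h c (g k) - h c' (g k)\<bar> \<le> e"
      using net(3)[of "g ` {..<n}" c] g c by blast
    have c'C: "c' \<in> C" using net(1)[of "g ` {..<n}"] g c' by auto
    \<comment> \<open>Both payoffs are affine in the density, so the estimate at the first
      \<open>n\<close> terms extends to their combination \<open>f\<close>.\<close>
    have "\<bar>h c f - h c' f\<bar> \<le> e"
      using f
    proof (induction rule: midpoint_hull.induct)
      case (base u) then show ?case using c'(2) by auto
    next
      case (midpoint u v)
      have "h c (\<lambda>\<omega>. (u \<omega> + v \<omega>) / 2) - h c' (\<lambda>\<omega>. (u \<omega> + v \<omega>) / 2) = ((h c u - h c' u) + (h c v - h c' v)) / 2"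
        using h_mid hull_G[OF midpoint.hyps(1)] hull_G[OF midpoint.hyps(2)] c(1) c'C by (simp add: field_simps)
      then show ?case using midpoint.IH by (simp add: abs_le_iff)
    qed
    moreover have "h c' f' \<le> V + e"
      using f'
    proof (induction rule: midpoint_hull.induct)
      case (base u) then show ?case using c'(1) g(2) by auto
    next
      case (midpoint u v)
      have "h c' (\<lambda>\<omega>. (u \<omega> + v \<omega>) / 2) = (h c' u + h c' v) / 2"
        using h_mid hull_G[OF midpoint.hyps(1)] hull_G[OF midpoint.hyps(2)] c'C by simp
      then show ?case using midpoint.IH by simp
    qed
    moreover have "h c' f - h c' f' \<le> e"
    proof -
      have i: "integrable M f" "integrable M f'" using int hull_G f f' by auto
      have "h c' f - h c' f' = (\<integral>\<omega>. f \<omega> * X c' \<omega> - f' \<omega> * X c' \<omega> \<partial>M)"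
        unfolding h_def using int_gX[OF i(1) c'C] int_gX[OF i(2) c'C] by simp
      also have "\<dots> \<le> (\<integral>\<omega>. \<bar>f \<omega> - f' \<omega>\<bar> \<partial>M)"
      proof (rule integral_mono)
        fix \<omega> assume "\<omega> \<in> space M"
        then have "\<bar>(f \<omega> - f' \<omega>) * X c' \<omega>\<bar> \<le> \<bar>f \<omega> - f' \<omega>\<bar>"
          using X(2)[OF c'C] by (simp add: abs_mult mult_left_le)
        then show "f \<omega> * X c' \<omega> - f' \<omega> * X c' \<omega> \<le> \<bar>f \<omega> - f' \<omega>\<bar>"
          by (simp add: algebra_simps abs_le_iff)
      qed (use i int_gX[OF i(1) c'C] int_gX[OF i(2) c'C] in auto)
      finally show ?thesis using close by linarith
    qed
    ultimately show ?thesis using c(2) by linarith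
  qed
  show ?thesis
  proof (rule field_le_epsilon)
    fix e :: real assume "0 < e"
    then show "W \<le> V + e" using bound[of "e / 4"] by simp
  qed
qed

section \<open>Optimal stopping\<close>

locale robust_stopping =
  fixes P :: "'a measure" and F :: "real \<Rightarrow> 'a measure" and T :: real
    and Y :: "real \<Rightarrow> 'a \<Rightarrow> real" and Qs :: "'a measure set"
  assumes setting: "filtered_setting P F T"
    and Y: "admissible_process P F T Y"
    and Qs: "admissible_measures P Qs"
    and L1: "Ystar T Y \<in> L1Q P Qs"
    and cont: "continuous_from_above_at_0 P T Y Qs"
begin

section \<open>The filtered setting and the envelope of \<open>Y\<close>\<close>

sublocale prob_space P
  using setting by (simp add: filtered_setting_def)

lemma T_pos: "0 < T" using setting by (simp add: filtered_setting_def)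

lemma F_space: "t \<in> {0..T} \<Longrightarrow> space (F t) = space P"
  and F_sub: "t \<in> {0..T} \<Longrightarrow> sets (F t) \<subseteq> sets P"
  and F_mono: "0 \<le> s \<Longrightarrow> s \<le> t \<Longrightarrow> t \<le> T \<Longrightarrow> sets (F s) \<subseteq> sets (F t)"
  using setting unfolding filtered_setting_def by blast+

lemma Y_le_Ystar:
  assumes "\<omega> \<in> space P" "t \<in> {0..T}"
  shows "\<bar>Y t \<omega>\<bar> \<le> Ystar T Y \<omega>"
  unfolding Ystar_def
proof (rule cSUP_upper[OF assms(2)])
  have "bounded ((\<lambda>t. Y t \<omega>) ` {0..T})"
    using Y assms(1) by (auto simp: admissible_process_def)
  then obtain K where "\<forall>t\<in>{0..T}. \<bar>Y t \<omega>\<bar> \<le> K" by (auto simp: bounded_iff)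
  then show "bdd_above ((\<lambda>t. \<bar>Y t \<omega>\<bar>) ` {0..T})"
    by (intro bdd_aboveI2[of _ _ K]) auto
qed

lemma Ystar_nonneg: "\<omega> \<in> space P \<Longrightarrow> 0 \<le> Ystar T Y \<omega>"
  using Y_le_Ystar[of \<omega> 0] T_pos by auto

lemma Ystar_measurable [measurable]: "Ystar T Y \<in> borel_measurable P"
  using L1 by (simp add: L1Q_def)

section \<open>Stopping times: strict sublevel sets, pasting, approximation\<close>

abbreviation "ST \<equiv> stopping_times P F T"

lemma ST_range: "\<tau> \<in> ST \<Longrightarrow> \<omega> \<in> space P \<Longrightarrow> \<tau> \<omega> \<in> {0..T}"
  and ST_sets: "\<tau> \<in> ST \<Longrightarrow> t \<in> {0..T} \<Longrightarrow> {\<omega>\<in>space P. \<tau> \<omega> \<le> t} \<in> sets (F t)"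
  by (auto simp: stopping_times_def)

lemma ST_measurable:
  assumes "\<tau> \<in> ST"
  shows "\<tau> \<in> borel_measurable P"
  unfolding borel_measurable_iff_le
proof
  fix a
  consider "a < 0" | "a \<in> {0..T}" | "T < a" by force
  then show "{\<omega>\<in>space P. \<tau> \<omega> \<le> a} \<in> sets P"
  proof cases
    case 1
    then have "{\<omega>\<in>space P. \<tau> \<omega> \<le> a} = {}" using ST_range[OF assms] by force
    then show ?thesis by (simp only: sets.empty_sets)
  next
    case 2
    then show ?thesis using ST_sets[OF assms] F_sub by blast
  next
    case 3
    then have "{\<omega>\<in>space P. \<tau> \<omega> \<le> a} = space P" using ST_range[OF assms] by force
    then show ?thesis by simp
  qed
qed

text \<open>Serves the grid approximation: strict rounding up turns a weak inequality for the
  rounded time into a strict one for \<open>\<tau>\<close>. The thresholds subtract fractions of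
  \<open>s\<close> itself and so never become negative.\<close>

lemma ST_less_sets:
  assumes \<tau>: "\<tau> \<in> ST" and t: "t \<in> {0..T}" and s: "s \<le> t"
  shows "{\<omega>\<in>space P. \<tau> \<omega> < s} \<in> sets (F t)"
proof (cases "0 < s")
  case False
  then have "{\<omega>\<in>space P. \<tau> \<omega> < s} = {}" using ST_range[OF \<tau>] by force
  then show ?thesis by (simp only: sets.empty_sets)
next
  case True
  have "{\<omega>\<in>space P. \<tau> \<omega> < s} = (\<Union>m. {\<omega>\<in>space P. \<tau> \<omega> \<le> s - s / real (Suc m)})"
  proof (intro equalityI subsetI)
    fix \<omega> assume "\<omega> \<in> {\<omega>\<in>space P. \<tau> \<omega> < s}"
    then have w: "\<omega> \<in> space P" "0 < (s - \<tau> \<omega>) / s" using True by auto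
    then obtain m where "inverse (real (Suc m)) < (s - \<tau> \<omega>) / s"
      using reals_Archimedean by blast
    then have "inverse (real (Suc m)) * s < s - \<tau> \<omega>" using True by (simp add: pos_less_divide_eq)
    then show "\<omega> \<in> (\<Union>m. {\<omega>\<in>space P. \<tau> \<omega> \<le> s - s / real (Suc m)})"
      using w(1) by (auto intro!: exI[of _ m] simp: divide_inverse mult.commute)
  next
    fix \<omega> assume "\<omega> \<in> (\<Union>m. {\<omega>\<in>space P. \<tau> \<omega> \<le> s - s / real (Suc m)})"
    then obtain m where "\<omega> \<in> space P" "\<tau> \<omega> \<le> s - s / real (Suc m)" by blast
    moreover have "0 < s / real (Suc m)" using True by simp
    ultimately show "\<omega> \<in> {\<omega>\<in>space P. \<tau> \<omega> < s}" by auto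
  qed
  also have "\<dots> \<in> sets (F t)"
  proof (rule sets.countable_UN'')
    fix m :: nat
    have "0 < s / real (Suc m)" "s / real (Suc m) \<le> s" using True by (auto simp: divide_simps)
    then have r: "0 \<le> s - s / real (Suc m)" "s - s / real (Suc m) \<le> t" using s by linarith+
    show "{\<omega>\<in>space P. \<tau> \<omega> \<le> s - s / real (Suc m)} \<in> sets (F t)"
      using ST_sets[OF \<tau>, of "s - s / real (Suc m)"] F_mono[OF r] r t by auto
  qed auto
  finally show ?thesis .
qed

text \<open>Pasting two stopping times that are not identically \<open>0\<close> may produce the zero stopping time;
  everywhere positive ones are stable under pasting and still approximate all stopping times.\<close>

definition simple_times :: "('a \<Rightarrow> real) set" where
  "simple_times = {\<tau> \<in> finite_stopping_times P F T. \<forall>\<omega>\<in>space P. 0 < \<tau> \<omega>}"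

lemma simple_times_ST: "\<tau> \<in> simple_times \<Longrightarrow> \<tau> \<in> ST"
  by (simp add: simple_times_def finite_stopping_times_def)

lemma simple_times_nonzero: "\<tau> \<in> simple_times \<Longrightarrow> \<tau> \<in> nonzero_finite_stopping_times P F T"
  using not_empty unfolding simple_times_def nonzero_finite_stopping_times_def by fastforce

text \<open>Whichever of the two times is followed, stopping by \<open>t\<close> forces the minimum
  to be at most \<open>t\<close>. So \<open>A\<close> may be replaced by its part \<open>B\<close>
  on that event, which is known at time \<open>t\<close>.\<close>

lemma simple_times_paste:
  assumes \<tau>: "\<tau>1 \<in> simple_times" "\<tau>2 \<in> simple_times" and A: "A \<in> stopped_sets P F T (\<lambda>\<omega>. min (\<tau>1 \<omega>) (\<tau>2 \<omega>))"
  shows "(\<lambda>\<omega>. if \<omega> \<in> A then \<tau>1 \<omega> else \<tau>2 \<omega>) \<in> simple_times"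
proof -
  let ?\<tau> = "\<lambda>\<omega>. if \<omega> \<in> A then \<tau>1 \<omega> else \<tau>2 \<omega>"
  have "{\<omega>\<in>space P. ?\<tau> \<omega> \<le> t} \<in> sets (F t)" if t: "t \<in> {0..T}" for t
  proof -
    define B where "B = A \<inter> {\<omega>\<in>space P. min (\<tau>1 \<omega>) (\<tau>2 \<omega>) \<le> t}"
    have "B \<in> sets (F t)" using A t by (simp add: stopped_sets_def B_def)
    moreover have "{\<omega>\<in>space P. ?\<tau> \<omega> \<le> t} =
        (B \<inter> {\<omega>\<in>space P. \<tau>1 \<omega> \<le> t}) \<union> ({\<omega>\<in>space P. \<tau>2 \<omega> \<le> t} - B)"
      by (auto simp: B_def)
    ultimately show ?thesis
      using ST_sets[OF simple_times_ST[OF \<tau>(1)] t] ST_sets[OF simple_times_ST[OF \<tau>(2)] t] by auto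
  qed
  moreover have "finite (?\<tau> ` space P)"
    by (rule finite_subset[of _ "\<tau>1 ` space P \<union> \<tau>2 ` space P"])
      (use \<tau> in \<open>auto simp: simple_times_def finite_stopping_times_def\<close>)
  ultimately show ?thesis
    using \<tau> by (auto simp: simple_times_def finite_stopping_times_def stopping_times_def)
qed

text \<open>Rounding up to a grid of mesh \<open>T / k n\<close> approaches \<open>\<tau>\<close>
  from the right, where the paths are continuous.\<close>

lemma simple_times_approximates:
  assumes \<tau>: "\<tau> \<in> ST"
  obtains \<sigma> :: "nat \<Rightarrow> 'a \<Rightarrow> real"
  where "\<And>n. \<sigma> n \<in> simple_times" "\<And>\<omega>. \<omega> \<in> space P \<Longrightarrow> (\<lambda>n. stopped Y (\<sigma> n) \<omega>) \<longlonglongrightarrow> stopped Y \<tau> \<omega>"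
proof
  define k where "k n = real (Suc n)" for n
  \<comment> \<open>Floor plus one is strict rounding: even a value on the grid moves up, so the
    result is positive and lies strictly above \<open>\<tau>\<close> when \<open>\<tau> < T\<close>.
    The cap keeps it within the horizon and leaves the value \<open>T\<close> fixed.\<close>
  define \<sigma> where "\<sigma> n \<omega> = min T (T * (real_of_int \<lfloor>k n * \<tau> \<omega> / T\<rfloor> + 1) / k n)" for n \<omega>
  have k: "0 < k n" for n by (simp add: k_def)
  have T: "0 < T" by (rule T_pos)
  have lower: "\<tau> \<omega> < T * (real_of_int \<lfloor>k n * \<tau> \<omega> / T\<rfloor> + 1) / k n" for n \<omega>
  proof -
    have "k n * \<tau> \<omega> / T < real_of_int \<lfloor>k n * \<tau> \<omega> / T\<rfloor> + 1" by linarith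
    then show ?thesis using k[of n] T by (simp add: field_simps)
  qed
  have upper: "T * (real_of_int \<lfloor>k n * \<tau> \<omega> / T\<rfloor> + 1) / k n \<le> \<tau> \<omega> + T / k n" for n \<omega>
  proof -
    have "real_of_int \<lfloor>k n * \<tau> \<omega> / T\<rfloor> + 1 \<le> k n * \<tau> \<omega> / T + 1" by linarith
    then have "T * (real_of_int \<lfloor>k n * \<tau> \<omega> / T\<rfloor> + 1) / k n \<le> T * (k n * \<tau> \<omega> / T + 1) / k n"
      using k[of n] T by (intro divide_right_mono mult_left_mono) auto
    also have "\<dots> = \<tau> \<omega> + T / k n" using k[of n] T by (simp add: field_simps)
    finally show ?thesis .
  qed
  show "\<sigma> n \<in> simple_times" for n
  proof -
    have pos: "0 < \<sigma> n \<omega>" "\<sigma> n \<omega> \<le> T" if "\<omega> \<in> space P" for \<omega>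
      using lower[of \<omega> n] ST_range[OF \<tau> that] T unfolding \<sigma>_def by auto
    have "{\<omega>\<in>space P. \<sigma> n \<omega> \<le> t} \<in> sets (F t)" if t: "t \<in> {0..T}" for t
    proof (cases "t = T")
      case True
      then have "{\<omega>\<in>space P. \<sigma> n \<omega> \<le> t} = space (F t)" using pos F_space[OF t] by auto
      then show ?thesis by simp
    next
      case False
      \<comment> \<open>\<open>s\<close> is the last grid point not after \<open>t\<close>; the
        rounded time is at most \<open>t\<close> exactly when \<open>\<tau>\<close> is before
        \<open>s\<close>.\<close>
      define s where "s = T * real_of_int \<lfloor>k n * t / T\<rfloor> / k n"
      have "s \<le> t"
      proof -
        have "s \<le> T * (k n * t / T) / k n"
          unfolding s_def using k[of n] T by (intro divide_right_mono mult_left_mono) auto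
        then show ?thesis using k[of n] T by simp
      qed
      have "\<sigma> n \<omega> \<le> t \<longleftrightarrow> \<tau> \<omega> < s" for \<omega>
      proof -
        have "\<sigma> n \<omega> \<le> t \<longleftrightarrow> T * (real_of_int \<lfloor>k n * \<tau> \<omega> / T\<rfloor> + 1) / k n \<le> t"
          using False t by (auto simp: \<sigma>_def)
        also have "\<dots> \<longleftrightarrow> real_of_int \<lfloor>k n * \<tau> \<omega> / T\<rfloor> + 1 \<le> k n * t / T"
          using k[of n] T by (simp add: field_simps)
        also have "\<dots> \<longleftrightarrow> k n * \<tau> \<omega> / T < real_of_int \<lfloor>k n * t / T\<rfloor>"
          using le_floor_iff[of "\<lfloor>k n * \<tau> \<omega> / T\<rfloor> + 1" "k n * t / T"]
            floor_less_iff[of "k n * \<tau> \<omega> / T" "\<lfloor>k n * t / T\<rfloor>"] by auto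
        also have "\<dots> \<longleftrightarrow> \<tau> \<omega> < s"
          unfolding s_def using k[of n] T by (simp add: field_simps)
        finally show ?thesis .
      qed
      then show ?thesis using ST_less_sets[OF \<tau> t \<open>s \<le> t\<close>] by simp
    qed
    moreover have "finite (\<sigma> n ` space P)"
    proof (rule finite_subset)
      show "\<sigma> n ` space P \<subseteq> (\<lambda>i. min T (T * (real_of_int i + 1) / k n)) ` {0..int (Suc n)}"
      proof (rule image_subsetI)
        fix \<omega> assume "\<omega> \<in> space P"
        then have "0 \<le> k n * \<tau> \<omega> / T" "k n * \<tau> \<omega> / T \<le> k n"
          using ST_range[OF \<tau>] k[of n] T by (auto simp: divide_simps)
        then have "\<lfloor>k n * \<tau> \<omega> / T\<rfloor> \<in> {0..int (Suc n)}" unfolding k_def by (auto simp: floor_le_iff)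
        then show "\<sigma> n \<omega> \<in> (\<lambda>i. min T (T * (real_of_int i + 1) / k n)) ` {0..int (Suc n)}"
          unfolding \<sigma>_def by (rule imageI)
      qed
    qed simp
    ultimately show ?thesis
      using pos by (auto simp: simple_times_def finite_stopping_times_def stopping_times_def less_imp_le)
  qed
  show "(\<lambda>n. stopped Y (\<sigma> n) \<omega>) \<longlonglongrightarrow> stopped Y \<tau> \<omega>" if \<omega>: "\<omega> \<in> space P" for \<omega>
  \<comment> \<open>At \<open>T\<close> there is no right limit to use; there the capped times equal
    \<open>T\<close> for every \<open>n\<close>.\<close>
  proof (cases "\<tau> \<omega> = T")
    case True
    then have "\<sigma> n \<omega> = T" for n using lower[of \<omega> n] by (simp add: \<sigma>_def)
    then show ?thesis using True by (simp add: stopped_def)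
  next
    case False
    then have \<tau>T: "\<tau> \<omega> \<in> {0..<T}" using ST_range[OF \<tau> \<omega>] by auto
    have "(\<lambda>n. \<sigma> n \<omega>) \<longlonglongrightarrow> \<tau> \<omega>"
    proof (rule tendsto_sandwich)
      show "\<forall>\<^sub>F n in sequentially. \<tau> \<omega> \<le> \<sigma> n \<omega>"
        using lower[of \<omega>] \<tau>T by (auto simp: \<sigma>_def less_imp_le)
      show "\<forall>\<^sub>F n in sequentially. \<sigma> n \<omega> \<le> \<tau> \<omega> + T / k n"
        using upper[of _ \<omega>] by (auto simp: \<sigma>_def intro!: always_eventually min.coboundedI2)
      have "(\<lambda>n. T / k n) \<longlonglongrightarrow> 0"
        unfolding k_def by (rule LIMSEQ_Suc[OF lim_const_over_n])
      from tendsto_add[OF tendsto_const this, of "\<tau> \<omega>"]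
      show "(\<lambda>n. \<tau> \<omega> + T / k n) \<longlonglongrightarrow> \<tau> \<omega>" by simp
    qed simp
    moreover have "\<forall>\<^sub>F n in sequentially. \<sigma> n \<omega> \<in> {\<tau> \<omega><..}"
      using lower[of \<omega>] \<tau>T by (auto simp: \<sigma>_def)
    ultimately have "filterlim (\<lambda>n. \<sigma> n \<omega>) (at_right (\<tau> \<omega>)) sequentially"
      by (auto intro: filterlim_at_withinI elim: eventually_mono)
    moreover have "((\<lambda>s. Y s \<omega>) \<longlongrightarrow> Y (\<tau> \<omega>) \<omega>) (at_right (\<tau> \<omega>))"
      using Y \<omega> \<tau>T by (auto simp: admissible_process_def continuous_within)
    ultimately show ?thesis unfolding stopped_def by (rule filterlim_compose[rotated])
  qed
qed

lemma stopped_le_Ystar: "\<tau> \<in> ST \<Longrightarrow> \<omega> \<in> space P \<Longrightarrow> \<bar>stopped Y \<tau> \<omega>\<bar> \<le> Ystar T Y \<omega>"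
  unfolding stopped_def by (intro Y_le_Ystar ST_range)

section \<open>Measurability of the stopped process\<close>

lemma stopped_measurable_simple:
  assumes "\<tau> \<in> simple_times"
  shows "stopped Y \<tau> \<in> borel_measurable P"
proof -
  have fin: "finite (\<tau> ` space P)" using assms by (simp add: simple_times_def finite_stopping_times_def)
  have [measurable]: "\<tau> \<in> borel_measurable P" by (rule ST_measurable[OF simple_times_ST[OF assms]])
  have "Y v \<in> borel_measurable P" if "v \<in> {0..T}" for v
  proof -
    have "Y v \<in> borel_measurable (F v)" using Y that by (simp add: admissible_process_def)
    then show ?thesis
      using F_sub[OF that] F_space[OF that] by (auto simp: measurable_def)
  qed
  then have Yv: "Y v \<in> borel_measurable P" if "v \<in> \<tau> ` space P" for v
    using ST_range[OF simple_times_ST[OF assms]] that by auto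
  have "(\<lambda>\<omega>. \<Sum>v\<in>\<tau> ` space P. indicator {\<omega>\<in>space P. \<tau> \<omega> = v} \<omega> * Y v \<omega>) \<in> borel_measurable P"
    using Yv by (intro borel_measurable_sum borel_measurable_times borel_measurable_indicator) auto
  moreover have "(\<Sum>v\<in>\<tau> ` space P. indicator {\<omega>\<in>space P. \<tau> \<omega> = v} \<omega> * Y v \<omega>) = stopped Y \<tau> \<omega>"
    if "\<omega> \<in> space P" for \<omega>
  proof -
    have "(\<Sum>v\<in>\<tau> ` space P. indicator {\<omega>\<in>space P. \<tau> \<omega> = v} \<omega> * Y v \<omega>)
        = (\<Sum>v\<in>\<tau> ` space P. if \<tau> \<omega> = v then Y v \<omega> else 0)"
      using that by (intro sum.cong) (auto simp: indicator_def)
    also have "\<dots> = stopped Y \<tau> \<omega>" using fin that by (simp add: stopped_def)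
    finally show ?thesis .
  qed
  ultimately show ?thesis by (subst measurable_cong[where g = "\<lambda>\<omega>. \<Sum>v\<in>\<tau> ` space P. indicator {\<omega>\<in>space P. \<tau> \<omega> = v} \<omega> * Y v \<omega>"]) auto
qed

text \<open>Passing through the approximation avoids joint measurability of \<open>Y\<close> in time
  and state; only the single \<open>Y v\<close> have to be measurable.\<close>

lemma stopped_measurable:
  assumes "\<tau> \<in> ST"
  shows "stopped Y \<tau> \<in> borel_measurable P"
proof -
  obtain \<sigma> :: "nat \<Rightarrow> 'a \<Rightarrow> real" where \<sigma>: "\<And>n. \<sigma> n \<in> simple_times" "\<And>\<omega>. \<omega> \<in> space P \<Longrightarrow> (\<lambda>n. stopped Y (\<sigma> n) \<omega>) \<longlonglongrightarrow> stopped Y \<tau> \<omega>"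
    using simple_times_approximates[OF assms] by blast
  show ?thesis
    by (rule borel_measurable_LIMSEQ_real[OF \<sigma>(2) stopped_measurable_simple[OF \<sigma>(1)]])
qed

subsection \<open>Densities of the convex hull\<close>

text \<open>Adding 1 makes the envelope strictly positive, so it can be divided by; it is also the
  comparison function in \<open>Xspace\<close>.\<close>

abbreviation u :: "'a \<Rightarrow> real" where "u \<equiv> \<lambda>\<omega>. Ystar T Y \<omega> + 1"

text \<open>An everywhere version of the bound in \<open>Xspace\<close>: it holds under each
  \<open>Q\<close> without moving null sets between measures.\<close>

definition dominated :: "('a \<Rightarrow> real) set" where
  "dominated = {X \<in> borel_measurable P. \<exists>K. \<forall>\<omega>\<in>space P. \<bar>X \<omega>\<bar> \<le> K * u \<omega>}"

lemma dominatedI: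
  assumes "X \<in> borel_measurable P" "\<And>\<omega>. \<omega> \<in> space P \<Longrightarrow> \<bar>X \<omega>\<bar> \<le> K * u \<omega>"
  shows "X \<in> dominated"
  unfolding dominated_def using assms by (intro CollectI conjI exI[of _ K] ballI)

lemma u_dominated: "u \<in> dominated"
  by (rule dominatedI[of _ 1]) (use Ystar_nonneg in auto)

lemma stopped_dominated: "\<tau> \<in> ST \<Longrightarrow> stopped Y \<tau> \<in> dominated"
  by (rule dominatedI[OF stopped_measurable, of _ 1]) (use stopped_le_Ystar in force)+

section \<open>Integrals bounded uniformly over \<open>Qs\<close>\<close>

lemma Q_props:
  assumes "Q \<in> Qs"
  shows "prob_space Q" "sets Q = sets P" "space Q = space P" "absolutely_continuous P Q"
proof -
  show "prob_space Q" "absolutely_continuous P Q" and eq: "sets Q = sets P"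
    using Qs assms by (auto simp: admissible_measures_def)
  show "space Q = space P" by (rule sets_eq_imp_space_eq[OF eq])
qed

lemma borel_Q: "Q \<in> Qs \<Longrightarrow> borel_measurable Q = borel_measurable P"
  by (rule measurable_cong_sets) (use Q_props in auto)

lemma Q_integrable:
  assumes Q: "Q \<in> Qs" and X: "X \<in> dominated"
  shows "integrable Q X"
proof -
  interpret Q: prob_space Q using Q_props[OF Q] by simp
  have "(\<integral>\<^sup>+\<omega>. ennreal \<bar>Ystar T Y \<omega>\<bar> \<partial>Q) \<le> (SUP Q\<in>Qs. \<integral>\<^sup>+\<omega>. ennreal \<bar>Ystar T Y \<omega>\<bar> \<partial>Q)"
    by (rule SUP_upper[OF Q])
  also have "\<dots> < \<infinity>" using L1 by (simp add: L1Q_def)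
  finally have fin: "(\<integral>\<^sup>+\<omega>. ennreal \<bar>Ystar T Y \<omega>\<bar> \<partial>Q) < \<infinity>" .
  have "integrable Q (Ystar T Y)"
  proof (rule integrableI_bounded)
    show "Ystar T Y \<in> borel_measurable Q"
      unfolding borel_Q[OF Q] by (rule Ystar_measurable)
  qed (use fin in simp)
  then have i: "integrable Q (\<lambda>\<omega>. K * u \<omega>)" for K
    by (intro integrable_mult_right Bochner_Integration.integrable_add Q.integrable_const)
  obtain K where K: "\<forall>\<omega>\<in>space P. \<bar>X \<omega>\<bar> \<le> K * u \<omega>" using X unfolding dominated_def by blast
  show ?thesis
  proof (rule Bochner_Integration.integrable_bound[OF i[of K]])
    show "X \<in> borel_measurable Q"
      using X unfolding borel_Q[OF Q] dominated_def by blast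
    show "AE \<omega> in Q. norm (X \<omega>) \<le> norm (K * u \<omega>)"
    proof (rule AE_I2)
      fix \<omega> assume "\<omega> \<in> space Q"
      then have "\<bar>X \<omega>\<bar> \<le> K * u \<omega>" using K Q_props(3)[OF Q] by blast
      then show "norm (X \<omega>) \<le> norm (K * u \<omega>)" unfolding real_norm_def by (rule order_trans[OF _ abs_ge_self])
    qed
  qed
qed

lemma u_integral_bound:
  obtains B where "0 \<le> B" "\<forall>Q\<in>Qs. (\<integral>\<omega>. u \<omega> \<partial>Q) \<le> B"
proof
  define S where "S = (SUP Q\<in>Qs. \<integral>\<^sup>+\<omega>. ennreal \<bar>Ystar T Y \<omega>\<bar> \<partial>Q)"
  have S: "S < top" using L1 by (simp add: L1Q_def S_def)
  show "0 \<le> enn2real S + 1" by simp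
  show "\<forall>Q\<in>Qs. (\<integral>\<omega>. u \<omega> \<partial>Q) \<le> enn2real S + 1"
  proof
    fix Q assume Q: "Q \<in> Qs"
    interpret Q: prob_space Q using Q_props[OF Q] by simp
    have Y: "Ystar T Y \<in> dominated"
      by (rule dominatedI[of _ 1]) (use Ystar_nonneg in auto)
    have i: "integrable Q (Ystar T Y)" by (rule Q_integrable[OF Q Y])
    have nn: "AE \<omega> in Q. 0 \<le> Ystar T Y \<omega>" using Ystar_nonneg Q_props(3)[OF Q] by (intro AE_I2) auto
    have "ennreal (\<integral>\<omega>. Ystar T Y \<omega> \<partial>Q) = (\<integral>\<^sup>+\<omega>. ennreal (Ystar T Y \<omega>) \<partial>Q)"
      by (rule nn_integral_eq_integral[OF i nn, symmetric])
    also have "\<dots> = (\<integral>\<^sup>+\<omega>. ennreal \<bar>Ystar T Y \<omega>\<bar> \<partial>Q)"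
      using Ystar_nonneg Q_props(3)[OF Q] by (intro nn_integral_cong) auto
    also have "\<dots> \<le> S" unfolding S_def by (rule SUP_upper[OF Q])
    finally have "enn2real (ennreal (\<integral>\<omega>. Ystar T Y \<omega> \<partial>Q)) \<le> enn2real S"
      using S by (rule enn2real_mono)
    then have "(\<integral>\<omega>. Ystar T Y \<omega> \<partial>Q) \<le> enn2real S"
      using integral_nonneg_AE[OF nn] by simp
    then show "(\<integral>\<omega>. u \<omega> \<partial>Q) \<le> enn2real S + 1" using i by (simp add: Q.prob_space)
  qed
qed

lemma dominated_integral_bound:
  assumes "X \<in> dominated"
  obtains K where "\<forall>Q\<in>Qs. \<bar>\<integral>\<omega>. X \<omega> \<partial>Q\<bar> \<le> K"
proof -
  obtain B where B: "0 \<le> B" "\<forall>Q\<in>Qs. (\<integral>\<omega>. u \<omega> \<partial>Q) \<le> B" using u_integral_bound by blast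
  obtain K where K: "\<forall>\<omega>\<in>space P. \<bar>X \<omega>\<bar> \<le> K * u \<omega>" using assms unfolding dominated_def by blast
  have "\<bar>\<integral>\<omega>. X \<omega> \<partial>Q\<bar> \<le> \<bar>K\<bar> * B" if Q: "Q \<in> Qs" for Q
  proof -
    have iu: "integrable Q u" by (rule Q_integrable[OF Q u_dominated])
    have "\<bar>\<integral>\<omega>. X \<omega> \<partial>Q\<bar> \<le> (\<integral>\<omega>. \<bar>X \<omega>\<bar> \<partial>Q)" by (rule integral_abs_bound)
    also have "\<dots> \<le> (\<integral>\<omega>. \<bar>K\<bar> * u \<omega> \<partial>Q)"
    proof (rule integral_mono)
      show "integrable Q (\<lambda>\<omega>. \<bar>X \<omega>\<bar>)" using Q_integrable[OF Q assms] by (rule integrable_abs)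
      show "integrable Q (\<lambda>\<omega>. \<bar>K\<bar> * u \<omega>)" using iu by (rule integrable_mult_right)
      fix \<omega> assume "\<omega> \<in> space Q"
      then have w: "\<omega> \<in> space P" using Q_props(3)[OF Q] by simp
      have "\<bar>X \<omega>\<bar> \<le> K * u \<omega>" using K w by blast
      also have "\<dots> \<le> \<bar>K\<bar> * u \<omega>" using Ystar_nonneg[OF w] by (intro mult_right_mono) auto
      finally show "\<bar>X \<omega>\<bar> \<le> \<bar>K\<bar> * u \<omega>" .
    qed
    also have "\<dots> = \<bar>K\<bar> * (\<integral>\<omega>. u \<omega> \<partial>Q)" by (rule Bochner_Integration.integral_mult_right_zero)
    also have "\<dots> \<le> \<bar>K\<bar> * B" by (rule mult_left_mono[OF bspec[OF B(2) Q]]) simp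
    finally show ?thesis .
  qed
  then show ?thesis by (intro that ballI)
qed

text \<open>\<open>rhoQ\<close> is a supremum in the reals and bounds its members only when they are
  bounded above, which domination by \<open>u\<close> provides.\<close>

lemma integral_le_rhoQ:
  assumes "X \<in> dominated" "Q \<in> Qs"
  shows "(\<integral>\<omega>. X \<omega> \<partial>Q) \<le> rhoQ Qs X"
proof -
  obtain K where "\<forall>Q\<in>Qs. \<bar>\<integral>\<omega>. X \<omega> \<partial>Q\<bar> \<le> K" using dominated_integral_bound[OF assms(1)] by blast
  then have "bdd_above ((\<lambda>Q. \<integral>\<omega>. X \<omega> \<partial>Q) ` Qs)" by (intro bdd_aboveI2[of _ _ K]) (auto simp: abs_le_iff)
  then show ?thesis unfolding rhoQ_def by (rule cSUP_upper[OF assms(2)])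
qed

text \<open>\<open>RN_deriv\<close> takes extended values and is determined only almost everywhere.
  A real version that is nonnegative everywhere permits sums and pointwise estimates without
  exceptional sets.\<close>

definition dens :: "'a measure \<Rightarrow> 'a \<Rightarrow> real" where
  "dens Q = (SOME D. D \<in> borel_measurable P \<and> (\<forall>\<omega>. 0 \<le> D \<omega>) \<and> Q = density P (\<lambda>\<omega>. ennreal (D \<omega>)))"

lemma dens:
  assumes Q: "Q \<in> Qs"
  shows "dens Q \<in> borel_measurable P" "\<And>\<omega>. 0 \<le> dens Q \<omega>" "Q = density P (\<lambda>\<omega>. ennreal (dens Q \<omega>))"
proof -
  interpret Q: prob_space Q using Q_props[OF Q] by simp
  obtain D where D: "D \<in> borel_measurable P" "AE x in P. RN_deriv P Q x = ennreal (D x)" "\<And>x. 0 \<le> D x"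
    using real_RN_deriv[OF Q.finite_measure_axioms Q_props(4)[OF Q] Q_props(2)[OF Q]] by metis
  have "Q = density P (RN_deriv P Q)"
    by (rule density_RN_deriv[OF Q_props(4,2)[OF Q], symmetric])
  also have "\<dots> = density P (\<lambda>\<omega>. ennreal (D \<omega>))"
    using D by (intro density_cong) auto
  finally have "\<exists>D. D \<in> borel_measurable P \<and> (\<forall>\<omega>. 0 \<le> D \<omega>) \<and> Q = density P (\<lambda>\<omega>. ennreal (D \<omega>))"
    using D by blast
  from someI_ex[OF this] show "dens Q \<in> borel_measurable P" "\<And>\<omega>. 0 \<le> dens Q \<omega>"
    "Q = density P (\<lambda>\<omega>. ennreal (dens Q \<omega>))" unfolding dens_def by blast+
qed

lemma dens_integral:
  assumes Q: "Q \<in> Qs" and X: "X \<in> dominated"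
  shows "integrable P (\<lambda>\<omega>. dens Q \<omega> * X \<omega>)" "(\<integral>\<omega>. X \<omega> \<partial>Q) = (\<integral>\<omega>. dens Q \<omega> * X \<omega> \<partial>P)"
proof -
  note d = dens[OF Q]
  have X': "X \<in> borel_measurable P" using X by (simp add: dominated_def)
  have "integrable (density P (\<lambda>\<omega>. ennreal (dens Q \<omega>))) X"
    using Q_integrable[OF Q X] d(3) by simp
  then show "integrable P (\<lambda>\<omega>. dens Q \<omega> * X \<omega>)"
    using d(1,2) X' by (simp add: integrable_density)
  have "(\<integral>\<omega>. X \<omega> \<partial>Q) = (\<integral>\<omega>. X \<omega> \<partial>density P (\<lambda>\<omega>. ennreal (dens Q \<omega>)))"
    using d(3) by simp
  also have "\<dots> = (\<integral>\<omega>. dens Q \<omega> * X \<omega> \<partial>P)"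
    using d(1,2) X' by (simp add: integral_density)
  finally show "(\<integral>\<omega>. X \<omega> \<partial>Q) = (\<integral>\<omega>. dens Q \<omega> * X \<omega> \<partial>P)" .
qed

definition weights :: "('a measure set \<times> ('a measure \<Rightarrow> real)) set" where
  "weights = {(S, w). finite S \<and> S \<noteq> {} \<and> S \<subseteq> Qs \<and> (\<forall>R\<in>S. 0 \<le> w R) \<and> sum w S = 1}"

definition conv_densities :: "('a \<Rightarrow> real) set" where
  "conv_densities = (\<lambda>(S, w) \<omega>. \<Sum>R\<in>S. w R * dens R \<omega>) ` weights"

lemma conv_densitiesE:
  assumes "g \<in> conv_densities"
  obtains S w where "finite S" "S \<noteq> {}" "S \<subseteq> Qs" "\<forall>R\<in>S. 0 \<le> w R" "sum w S = 1"
    "g = (\<lambda>\<omega>. \<Sum>R\<in>S. w R * dens R \<omega>)"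
proof -
  obtain S w where "(S, w) \<in> weights" "g = (\<lambda>\<omega>. \<Sum>R\<in>S. w R * dens R \<omega>)"
    using assms unfolding conv_densities_def by auto
  then show ?thesis by (intro that[of S w]) (auto simp: weights_def)
qed

lemma conv_densitiesI:
  assumes "finite S" "S \<noteq> {}" "S \<subseteq> Qs" "\<forall>R\<in>S. 0 \<le> w R" "sum w S = 1"
  shows "(\<lambda>\<omega>. \<Sum>R\<in>S. w R * dens R \<omega>) \<in> conv_densities"
proof -
  have "(S, w) \<in> weights" using assms by (simp add: weights_def)
  then show ?thesis unfolding conv_densities_def by (rule rev_image_eqI) simp
qed

lemma dens_conv_densities: "Q \<in> Qs \<Longrightarrow> dens Q \<in> conv_densities"
  using conv_densitiesI[of "{Q}" "\<lambda>_. 1"] by simp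

lemma conv_densities_props:
  assumes "g \<in> conv_densities"
  shows "g \<in> borel_measurable P" "0 \<le> g \<omega>"
proof -
  obtain S w where S: "finite S" "S \<noteq> {}" "S \<subseteq> Qs" "\<forall>R\<in>S. 0 \<le> w R" "sum w S = 1"
    "g = (\<lambda>\<omega>. \<Sum>R\<in>S. w R * dens R \<omega>)" using conv_densitiesE[OF assms] by blast
  have R: "R \<in> Qs" if "R \<in> S" for R using S(3) that by blast
  show "g \<in> borel_measurable P"
    unfolding S(6) by (intro borel_measurable_sum borel_measurable_times borel_measurable_const dens(1) R)
  show "0 \<le> g \<omega>"
    unfolding S(6) by (intro sum_nonneg mult_nonneg_nonneg bspec[OF S(4)] dens(2) R)
qed

lemma conv_densities_mix:
  assumes g: "g \<in> conv_densities" "g' \<in> conv_densities" and t: "0 \<le> t" "t \<le> 1"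
  shows "(\<lambda>\<omega>. t * g \<omega> + (1 - t) * g' \<omega>) \<in> conv_densities"
proof -
  obtain S w where S: "finite S" "S \<noteq> {}" "S \<subseteq> Qs" "\<forall>R\<in>S. 0 \<le> w R" "sum w S = 1"
    "g = (\<lambda>\<omega>. \<Sum>R\<in>S. w R * dens R \<omega>)" using conv_densitiesE[OF g(1)] by blast
  obtain S' w' where S': "finite S'" "S' \<noteq> {}" "S' \<subseteq> Qs" "\<forall>R\<in>S'. 0 \<le> w' R" "sum w' S' = 1"
    "g' = (\<lambda>\<omega>. \<Sum>R\<in>S'. w' R * dens R \<omega>)" using conv_densitiesE[OF g(2)] by blast
  \<comment> \<open>The weights are extended by 0 because \<open>w\<close> and \<open>w'\<close> are
    arbitrary outside \<open>S\<close> and \<open>S'\<close>. The identity \<open>split\<close> then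
    serves both for the densities and, with the constant 1, for the total weight.\<close>
  define v where "v R = t * (if R \<in> S then w R else 0) + (1 - t) * (if R \<in> S' then w' R else 0)" for R
  have split: "(\<Sum>R\<in>S\<union>S'. v R * f R) = t * (\<Sum>R\<in>S. w R * f R) + (1 - t) * (\<Sum>R\<in>S'. w' R * f R)" for f
  proof -
    have "(\<Sum>R\<in>S\<union>S'. v R * f R) = t * (\<Sum>R\<in>S\<union>S'. if R \<in> S then w R * f R else 0)
        + (1 - t) * (\<Sum>R\<in>S\<union>S'. if R \<in> S' then w' R * f R else 0)"
      unfolding sum_distrib_left sum.distrib[symmetric] by (intro sum.cong) (auto simp: v_def algebra_simps)
    also have "(\<Sum>R\<in>S\<union>S'. if R \<in> S then w R * f R else 0) = (\<Sum>R\<in>S. w R * f R)"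
      using S(1) S'(1) by (subst sum.inter_restrict[symmetric]) (auto intro: sum.cong simp: Int_absorb1)
    also have "(\<Sum>R\<in>S\<union>S'. if R \<in> S' then w' R * f R else 0) = (\<Sum>R\<in>S'. w' R * f R)"
      using S(1) S'(1) by (subst sum.inter_restrict[symmetric]) (auto intro: sum.cong simp: Int_absorb1)
    finally show ?thesis .
  qed
  have "(\<lambda>\<omega>. \<Sum>R\<in>S\<union>S'. v R * dens R \<omega>) \<in> conv_densities"
  proof (rule conv_densitiesI)
    show "\<forall>R\<in>S \<union> S'. 0 \<le> v R" using S(4) S'(4) t by (auto simp: v_def)
    show "sum v (S \<union> S') = 1" using split[of "\<lambda>_. 1"] S(5) S'(5) by simp
  qed (use S S' in auto)
  then show ?thesis unfolding split S(6) S'(6) .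
qed

lemma conv_densities_integral:
  assumes S: "finite S" "S \<subseteq> Qs" and X: "X \<in> dominated"
  shows "integrable P (\<lambda>\<omega>. (\<Sum>R\<in>S. w R * dens R \<omega>) * X \<omega>)"
    "(\<integral>\<omega>. (\<Sum>R\<in>S. w R * dens R \<omega>) * X \<omega> \<partial>P) = (\<Sum>R\<in>S. w R * (\<integral>\<omega>. X \<omega> \<partial>R))"
proof -
  have eq: "(\<lambda>\<omega>. (\<Sum>R\<in>S. w R * dens R \<omega>) * X \<omega>) = (\<lambda>\<omega>. \<Sum>R\<in>S. w R * (dens R \<omega> * X \<omega>))"
    by (simp add: sum_distrib_right mult.assoc)
  have i: "integrable P (\<lambda>\<omega>. w R * (dens R \<omega> * X \<omega>))" if "R \<in> S" for R
    using dens_integral(1)[of R X] that S X by (intro integrable_mult_right) auto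
  show "integrable P (\<lambda>\<omega>. (\<Sum>R\<in>S. w R * dens R \<omega>) * X \<omega>)"
    unfolding eq using i by (rule Bochner_Integration.integrable_sum)
  have "(\<integral>\<omega>. (\<Sum>R\<in>S. w R * dens R \<omega>) * X \<omega> \<partial>P) = (\<Sum>R\<in>S. \<integral>\<omega>. w R * (dens R \<omega> * X \<omega>) \<partial>P)"
    unfolding eq using i by (rule Bochner_Integration.integral_sum)
  also have "\<dots> = (\<Sum>R\<in>S. w R * (\<integral>\<omega>. X \<omega> \<partial>R))"
    using S X by (intro sum.cong) (auto simp: dens_integral(2))
  finally show "(\<integral>\<omega>. (\<Sum>R\<in>S. w R * dens R \<omega>) * X \<omega> \<partial>P) = (\<Sum>R\<in>S. w R * (\<integral>\<omega>. X \<omega> \<partial>R))" .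
qed

lemma conv_integrable:
  assumes g: "g \<in> conv_densities" and X: "X \<in> dominated"
  shows "integrable P (\<lambda>\<omega>. g \<omega> * X \<omega>)"
proof -
  obtain S w where S: "finite S" "S \<noteq> {}" "S \<subseteq> Qs" "\<forall>R\<in>S. 0 \<le> w R" "sum w S = 1"
    "g = (\<lambda>\<omega>. \<Sum>R\<in>S. w R * dens R \<omega>)" using conv_densitiesE[OF g] by blast
  show ?thesis unfolding S(6) by (rule conv_densities_integral(1)[OF S(1,3) X])
qed

text \<open>A bound valid for every \<open>Q\<close> in \<open>Qs\<close> survives averaging; this
  is how \<open>rhoQ\<close>, a supremum over \<open>Qs\<close> alone, controls the whole
  hull.\<close>

lemma conv_integral_le:
  assumes g: "g \<in> conv_densities" and X: "X \<in> dominated" and b: "\<And>Q. Q \<in> Qs \<Longrightarrow> (\<integral>\<omega>. X \<omega> \<partial>Q) \<le> b"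
  shows "(\<integral>\<omega>. g \<omega> * X \<omega> \<partial>P) \<le> b"
proof -
  obtain S w where S: "finite S" "S \<noteq> {}" "S \<subseteq> Qs" "\<forall>R\<in>S. 0 \<le> w R" "sum w S = 1"
    "g = (\<lambda>\<omega>. \<Sum>R\<in>S. w R * dens R \<omega>)" using conv_densitiesE[OF g] by blast
  have "(\<integral>\<omega>. g \<omega> * X \<omega> \<partial>P) = (\<Sum>R\<in>S. w R * (\<integral>\<omega>. X \<omega> \<partial>R))"
    unfolding S(6) by (rule conv_densities_integral(2)[OF S(1,3) X])
  also have "\<dots> \<le> (\<Sum>R\<in>S. w R * b)"
    using S(3,4) b by (intro sum_mono mult_left_mono) auto
  also have "\<dots> = b" using S(5) by (simp add: sum_distrib_right[symmetric])
  finally show ?thesis .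
qed

lemma conv_integral_ge:
  assumes g: "g \<in> conv_densities" and X: "X \<in> dominated" and b: "\<And>Q. Q \<in> Qs \<Longrightarrow> b \<le> (\<integral>\<omega>. X \<omega> \<partial>Q)"
  shows "b \<le> (\<integral>\<omega>. g \<omega> * X \<omega> \<partial>P)"
proof -
  have "(\<lambda>\<omega>. - X \<omega>) \<in> dominated" using X by (auto simp: dominated_def)
  from conv_integral_le[OF g this, of "- b"] b show ?thesis by simp
qed

lemma emeasure_density_conv:
  assumes S: "finite S" "S \<subseteq> Qs" "\<forall>R\<in>S. 0 \<le> w R" and A: "A \<in> sets P"
  shows "emeasure (density P (\<lambda>\<omega>. ennreal (\<Sum>R\<in>S. w R * dens R \<omega>))) A
    = (\<Sum>R\<in>S. ennreal (w R) * emeasure R A)"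
proof -
  note A[measurable]
  have m: "dens R \<in> borel_measurable P" if "R \<in> S" for R using dens(1) S(2) that by blast
  have nn: "0 \<le> dens R \<omega>" if "R \<in> S" for R \<omega> using dens(2) S(2) that by blast
  have "emeasure (density P (\<lambda>\<omega>. ennreal (\<Sum>R\<in>S. w R * dens R \<omega>))) A
      = (\<integral>\<^sup>+\<omega>. ennreal (\<Sum>R\<in>S. w R * dens R \<omega>) * indicator A \<omega> \<partial>P)"
    using m A by (intro emeasure_density) measurable
  also have "\<dots> = (\<integral>\<^sup>+\<omega>. (\<Sum>R\<in>S. ennreal (w R) * (ennreal (dens R \<omega>) * indicator A \<omega>)) \<partial>P)"
    using S(3) nn by (intro nn_integral_cong)
      (simp add: sum_ennreal[symmetric] ennreal_mult sum_distrib_right mult.assoc)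
  also have "\<dots> = (\<Sum>R\<in>S. \<integral>\<^sup>+\<omega>. ennreal (w R) * (ennreal (dens R \<omega>) * indicator A \<omega>) \<partial>P)"
    using m A by (intro nn_integral_sum borel_measurable_times_ennreal borel_measurable_const measurable_compose[OF _ measurable_ennreal] borel_measurable_indicator)
  also have "\<dots> = (\<Sum>R\<in>S. ennreal (w R) * emeasure R A)"
  proof (rule sum.cong[OF refl])
    fix R assume R: "R \<in> S"
    have [measurable]: "dens R \<in> borel_measurable P" by (rule m[OF R])
    have "(\<integral>\<^sup>+\<omega>. ennreal (w R) * (ennreal (dens R \<omega>) * indicator A \<omega>) \<partial>P)
        = ennreal (w R) * (\<integral>\<^sup>+\<omega>. ennreal (dens R \<omega>) * indicator A \<omega> \<partial>P)"
      by (intro nn_integral_cmult) measurable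
    also have "(\<integral>\<^sup>+\<omega>. ennreal (dens R \<omega>) * indicator A \<omega> \<partial>P) = emeasure (density P (\<lambda>\<omega>. ennreal (dens R \<omega>))) A"
      by (intro emeasure_density[symmetric] A) measurable
    also have "density P (\<lambda>\<omega>. ennreal (dens R \<omega>)) = R"
      using dens(3)[of R] R S(2) by auto
    finally show "(\<integral>\<^sup>+\<omega>. ennreal (w R) * (ennreal (dens R \<omega>) * indicator A \<omega>) \<partial>P) = ennreal (w R) * emeasure R A" .
  qed
  finally show ?thesis .
qed

text \<open>Replaces the measures of the hull by functions on the one space \<open>P\<close>, where
  the L1 arguments take place.\<close>

lemma conv_measures_eq: "conv_measures P Qs = (\<lambda>g. density P (\<lambda>\<omega>. ennreal (g \<omega>))) ` conv_densities"
proof (intro equalityI subsetI)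
  fix Q assume "Q \<in> conv_measures P Qs"
  then obtain S w where Q: "sets Q = sets P" "finite S" "S \<noteq> {}" "S \<subseteq> Qs" "\<forall>R\<in>S. 0 \<le> w R" "sum w S = 1"
    "\<And>A. A \<in> sets P \<Longrightarrow> emeasure Q A = (\<Sum>R\<in>S. ennreal (w R) * emeasure R A)"
    unfolding conv_measures_def by blast
  have "Q = density P (\<lambda>\<omega>. ennreal (\<Sum>R\<in>S. w R * dens R \<omega>))"
    using Q emeasure_density_conv[OF Q(2,4,5)] by (intro measure_eqI) auto
  then show "Q \<in> (\<lambda>g. density P (\<lambda>\<omega>. ennreal (g \<omega>))) ` conv_densities"
    using conv_densitiesI[OF Q(2-6)] by (rule image_eqI)
next
  fix Q assume "Q \<in> (\<lambda>g. density P (\<lambda>\<omega>. ennreal (g \<omega>))) ` conv_densities"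
  then obtain g where g: "g \<in> conv_densities" "Q = density P (\<lambda>\<omega>. ennreal (g \<omega>))" by blast
  obtain S w where S: "finite S" "S \<noteq> {}" "S \<subseteq> Qs" "\<forall>R\<in>S. 0 \<le> w R" "sum w S = 1"
    "g = (\<lambda>\<omega>. \<Sum>R\<in>S. w R * dens R \<omega>)" using conv_densitiesE[OF g(1)] by blast
  have "\<forall>A\<in>sets P. emeasure Q A = (\<Sum>R\<in>S. ennreal (w R) * emeasure R A)"
    unfolding g(2) S(6) using emeasure_density_conv[OF S(1,3,4)] by blast
  moreover have "sets Q = sets P" by (simp add: g(2))
  ultimately show "Q \<in> conv_measures P Qs"
    unfolding conv_measures_def using S(1-5) by blast
qed

lemma conv_integral:
  assumes "g \<in> conv_densities" "X \<in> dominated"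
  shows "(\<integral>\<omega>. X \<omega> \<partial>density P (\<lambda>\<omega>. ennreal (g \<omega>))) = (\<integral>\<omega>. g \<omega> * X \<omega> \<partial>P)"
  using conv_densities_props[OF assms(1)] assms(2) by (simp add: integral_density dominated_def)

lemma Qs_subset_conv: "Qs \<subseteq> conv_measures P Qs"
  unfolding conv_measures_eq using dens(3) dens_conv_densities by blast

text \<open>If uniform integrability failed, Borel-Cantelli applied to the tail sets of a bad sequence
  of densities would contradict continuity from above.\<close>

lemma conv_densities_uniformly_integrable:
  assumes d: "0 < d"
  shows "\<exists>N. \<forall>g\<in>conv_densities. (\<integral>\<omega>. max (g \<omega> * u \<omega> - N) 0 \<partial>P) \<le> d"
proof (rule ccontr)
  assume "\<not> ?thesis"
  \<comment> \<open>The thresholds \<open>2 ^ n\<close> make Markov's bound \<open>B / 2 ^ n\<close>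
    for the tail sets summable.\<close>
  then have "\<forall>n::nat. \<exists>g\<in>conv_densities. d < (\<integral>\<omega>. max (g \<omega> * u \<omega> - 2 ^ n) 0 \<partial>P)"
    by (meson not_le)
  then obtain g :: "nat \<Rightarrow> 'a \<Rightarrow> real" where g: "\<And>n. g n \<in> conv_densities"
    "\<And>n. d < (\<integral>\<omega>. max (g n \<omega> * u \<omega> - 2 ^ n) 0 \<partial>P)" by metis
  have [measurable]: "g n \<in> borel_measurable P" for n by (rule conv_densities_props[OF g(1)])
  have gu0: "0 \<le> g n \<omega> * u \<omega>" if "\<omega> \<in> space P" for n \<omega>
    using conv_densities_props(2)[OF g(1)] Ystar_nonneg[OF that] by simp
  obtain B where "0 \<le> B" and B: "\<forall>Q\<in>Qs. (\<integral>\<omega>. u \<omega> \<partial>Q) \<le> B" using u_integral_bound by blast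
  have gu: "integrable P (\<lambda>\<omega>. g n \<omega> * u \<omega>)" "(\<integral>\<omega>. g n \<omega> * u \<omega> \<partial>P) \<le> B" for n
    by (rule conv_integrable[OF g(1) u_dominated], rule conv_integral_le[OF g(1) u_dominated bspec[OF B]])
  define A where "A n = {\<omega>\<in>space P. 2 ^ n \<le> g n \<omega> * u \<omega>}" for n
  have [measurable]: "A n \<in> sets P" for n unfolding A_def by measurable
  have A_le: "measure P (A n) \<le> B / 2 ^ n" for n
  proof -
    have "measure P (A n) \<le> (\<integral>\<omega>. g n \<omega> * u \<omega> \<partial>P) / 2 ^ n"
      unfolding A_def using gu(1)[of n] gu0 by (intro integral_Markov_inequality_measure[of _ _ "{}"] AE_I2) auto
    also have "\<dots> \<le> B / 2 ^ n" using gu(2) by (intro divide_right_mono) auto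
    finally show ?thesis .
  qed
  have "summable (\<lambda>n. B / 2 ^ n)"
    using summable_mult[OF summable_geometric[of "1/2::real"], of B] by (simp add: power_divide)
  then have A_sum: "summable (\<lambda>n. measure P (A n))"
  proof (rule summable_comparison_test')
    show "norm (measure P (A n)) \<le> B / 2 ^ n" for n
      unfolding real_norm_def abs_of_nonneg[OF measure_nonneg] by (rule A_le)
  qed
  have BC: "AE \<omega> in P. \<forall>\<^sub>F n in sequentially. \<omega> \<in> space P - A n"
    by (rule borel_cantelli_AE1[OF _ _ A_sum]) (simp_all add: emeasure_eq_measure)
  \<comment> \<open>The union over all later \<open>A m\<close> makes \<open>Z n\<close> decrease in
    \<open>n\<close>; almost every point lies in only finitely many \<open>A m\<close>, so
    \<open>Z n\<close> is eventually 0 there.\<close>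
  define Z where "Z n \<omega> = indicator (\<Union>m\<in>{n..}. A m) \<omega> * u \<omega>" for n \<omega>
  have Z_meas: "Z n \<in> borel_measurable P" for n unfolding Z_def by measurable
  have Z_bd: "0 \<le> Z n \<omega>" "Z n \<omega> \<le> u \<omega>" if "\<omega> \<in> space P" for n \<omega>
    using Ystar_nonneg[OF that] by (auto simp: Z_def indicator_def)
  have Z_dom: "Z n \<in> dominated" for n
    by (rule dominatedI[OF Z_meas, of _ 1]) (use Z_bd in auto)
  have Z_X: "Z n \<in> Xspace P T Y" for n
    using Z_meas Z_bd by (auto simp: Xspace_def intro!: exI[of _ 1] AE_I2)
  have "AE \<omega> in P. decseq (\<lambda>n. Z n \<omega>) \<and> (\<lambda>n. Z n \<omega>) \<longlonglongrightarrow> 0"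
    using BC AE_space
  proof eventually_elim
    case (elim \<omega>)
    then obtain N where N: "\<And>n. N \<le> n \<Longrightarrow> \<omega> \<notin> A n" by (auto simp: eventually_sequentially)
    have "decseq (\<lambda>n. Z n \<omega>)"
      using Ystar_nonneg[OF elim(2)] unfolding Z_def decseq_def
      by (intro allI impI mult_right_mono) (auto simp: indicator_def)
    moreover have "\<forall>\<^sub>F n in sequentially. Z n \<omega> = 0"
      unfolding eventually_sequentially Z_def using N by (intro exI[of _ N]) (fastforce simp: indicator_def)
    ultimately show ?case by (auto intro: tendsto_eventually)
  qed
  then have "(\<lambda>n. rhoQ Qs (Z n)) \<longlonglongrightarrow> 0"
    using cont Z_X unfolding continuous_from_above_at_0_def by blast
  then have "\<forall>\<^sub>F n in sequentially. rhoQ Qs (Z n) < d" using d by (rule order_tendstoD)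
  then obtain n where n: "rhoQ Qs (Z n) < d" by (auto simp: eventually_sequentially)
  \<comment> \<open>The excess of \<open>g n * u\<close> over \<open>2 ^ n\<close> lives on
    \<open>A n\<close>, where \<open>Z n\<close> equals \<open>u\<close>.\<close>
  have "(\<integral>\<omega>. max (g n \<omega> * u \<omega> - 2 ^ n) 0 \<partial>P) \<le> (\<integral>\<omega>. g n \<omega> * Z n \<omega> \<partial>P)"
  proof (rule integral_mono)
    show "integrable P (\<lambda>\<omega>. max (g n \<omega> * u \<omega> - 2 ^ n) 0)"
      using gu(1)[of n] by (intro Bochner_Integration.integrable_max Bochner_Integration.integrable_diff) auto
    show "integrable P (\<lambda>\<omega>. g n \<omega> * Z n \<omega>)" by (rule conv_integrable[OF g(1) Z_dom])
    fix \<omega> assume w: "\<omega> \<in> space P"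
    show "max (g n \<omega> * u \<omega> - 2 ^ n) 0 \<le> g n \<omega> * Z n \<omega>"
    proof (cases "\<omega> \<in> A n")
      case True
      then have "\<omega> \<in> (\<Union>m\<in>{n..}. A m)" by auto
      then have "Z n \<omega> = u \<omega>" unfolding Z_def by simp
      then show ?thesis using gu0[OF w, of n] by (simp add: max_def)
    next
      case False
      then have "g n \<omega> * u \<omega> < 2 ^ n" using w by (simp add: A_def)
      moreover have "0 \<le> g n \<omega> * Z n \<omega>"
        using conv_densities_props(2)[OF g(1)] Z_bd(1)[OF w] by (intro mult_nonneg_nonneg) auto
      ultimately show ?thesis by (simp add: max_def)
    qed
  qed
  also have "\<dots> \<le> rhoQ Qs (Z n)"
    by (rule conv_integral_le[OF g(1) Z_dom integral_le_rhoQ[OF Z_dom]])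
  finally show False using g(2)[of n] n by linarith
qed

subsection \<open>The minimax equality\<close>

lemma stopped_le_u: "\<tau> \<in> ST \<Longrightarrow> \<omega> \<in> space P \<Longrightarrow> \<bar>stopped Y \<tau> \<omega>\<bar> \<le> u \<omega>"
  using stopped_le_Ystar[of \<tau> \<omega>] by simp

text \<open>Dominated convergence with majorant \<open>g * u\<close>; hence restricting to
  \<open>simple_times\<close> does not lower the best payoff against a fixed density.\<close>

lemma simple_times_approximates_integral:
  assumes g: "g \<in> conv_densities" and \<tau>: "\<tau> \<in> ST" and e: "0 < e"
  shows "\<exists>\<sigma>\<in>simple_times. (\<integral>\<omega>. g \<omega> * stopped Y \<tau> \<omega> \<partial>P) - e < (\<integral>\<omega>. g \<omega> * stopped Y \<sigma> \<omega> \<partial>P)"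
proof -
  obtain \<sigma> :: "nat \<Rightarrow> 'a \<Rightarrow> real" where \<sigma>: "\<And>n. \<sigma> n \<in> simple_times"
    "\<And>\<omega>. \<omega> \<in> space P \<Longrightarrow> (\<lambda>n. stopped Y (\<sigma> n) \<omega>) \<longlonglongrightarrow> stopped Y \<tau> \<omega>"
    using simple_times_approximates[OF \<tau>] by blast
  note [measurable] = conv_densities_props(1)[OF g] stopped_measurable[OF \<tau>] stopped_measurable_simple[OF \<sigma>(1)]
  have "(\<lambda>n. \<integral>\<omega>. g \<omega> * stopped Y (\<sigma> n) \<omega> \<partial>P) \<longlonglongrightarrow> (\<integral>\<omega>. g \<omega> * stopped Y \<tau> \<omega> \<partial>P)"
  proof (rule integral_dominated_convergence[where w = "\<lambda>\<omega>. g \<omega> * u \<omega>"])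
    show "integrable P (\<lambda>\<omega>. g \<omega> * u \<omega>)" by (rule conv_integrable[OF g u_dominated])
    show "AE \<omega> in P. (\<lambda>n. g \<omega> * stopped Y (\<sigma> n) \<omega>) \<longlonglongrightarrow> g \<omega> * stopped Y \<tau> \<omega>"
      by (intro AE_I2 tendsto_mult tendsto_const \<sigma>(2))
    show "AE \<omega> in P. norm (g \<omega> * stopped Y (\<sigma> n) \<omega>) \<le> g \<omega> * u \<omega>" for n
    proof (rule AE_I2)
      fix \<omega> assume "\<omega> \<in> space P"
      then have "g \<omega> * \<bar>stopped Y (\<sigma> n) \<omega>\<bar> \<le> g \<omega> * u \<omega>"
        by (intro mult_left_mono stopped_le_u simple_times_ST \<sigma>(1) conv_densities_props(2)[OF g])
      then show "norm (g \<omega> * stopped Y (\<sigma> n) \<omega>) \<le> g \<omega> * u \<omega>"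
        using conv_densities_props(2)[OF g, of \<omega>] by (simp add: abs_mult)
    qed
  qed measurable
  then have "\<forall>\<^sub>F n in sequentially. (\<integral>\<omega>. g \<omega> * stopped Y \<tau> \<omega> \<partial>P) - e < (\<integral>\<omega>. g \<omega> * stopped Y (\<sigma> n) \<omega> \<partial>P)"
    by (rule order_tendstoD(1)) (use e in simp)
  then obtain n where n: "(\<integral>\<omega>. g \<omega> * stopped Y \<tau> \<omega> \<partial>P) - e < (\<integral>\<omega>. g \<omega> * stopped Y (\<sigma> n) \<omega> \<partial>P)"
    using eventually_happens'[OF sequentially_bot] by blast
  show ?thesis using n \<sigma>(1) by (intro bexI[of _ "\<sigma> n"])
qed

text \<open>A single bound for all measures and times makes the suprema and infima of the values
  genuine in the reals.\<close>

lemma stopped_integral_bound: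
  "\<exists>B. \<forall>Q\<in>conv_measures P Qs. \<forall>\<tau>\<in>ST. \<bar>\<integral>\<omega>. stopped Y \<tau> \<omega> \<partial>Q\<bar> \<le> B"
proof -
  obtain B where "0 \<le> B" and B: "\<forall>Q\<in>Qs. (\<integral>\<omega>. u \<omega> \<partial>Q) \<le> B" using u_integral_bound by blast
  have "\<bar>\<integral>\<omega>. stopped Y \<tau> \<omega> \<partial>Q\<bar> \<le> B" if Q: "Q \<in> conv_measures P Qs" and \<tau>: "\<tau> \<in> ST" for Q \<tau>
  proof -
    obtain g where g: "g \<in> conv_densities" "Q = density P (\<lambda>\<omega>. ennreal (g \<omega>))"
      using Q unfolding conv_measures_eq by blast
    note d = stopped_dominated[OF \<tau>]
    have "\<bar>\<integral>\<omega>. stopped Y \<tau> \<omega> \<partial>Q\<bar> = \<bar>\<integral>\<omega>. g \<omega> * stopped Y \<tau> \<omega> \<partial>P\<bar>"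
      unfolding g(2) conv_integral[OF g(1) d] ..
    also have "\<dots> \<le> (\<integral>\<omega>. \<bar>g \<omega> * stopped Y \<tau> \<omega>\<bar> \<partial>P)" by (rule integral_abs_bound)
    also have "\<dots> \<le> (\<integral>\<omega>. g \<omega> * u \<omega> \<partial>P)"
    proof (rule integral_mono)
      show "integrable P (\<lambda>\<omega>. \<bar>g \<omega> * stopped Y \<tau> \<omega>\<bar>)"
        using conv_integrable[OF g(1) d] by (rule integrable_abs)
      show "integrable P (\<lambda>\<omega>. g \<omega> * u \<omega>)" by (rule conv_integrable[OF g(1) u_dominated])
      fix \<omega> assume "\<omega> \<in> space P"
      then have "g \<omega> * \<bar>stopped Y \<tau> \<omega>\<bar> \<le> g \<omega> * u \<omega>"
        by (intro mult_left_mono stopped_le_u \<tau> conv_densities_props(2)[OF g(1)])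
      then show "\<bar>g \<omega> * stopped Y \<tau> \<omega>\<bar> \<le> g \<omega> * u \<omega>"
        using conv_densities_props(2)[OF g(1), of \<omega>] by (simp add: abs_mult)
    qed
    also have "\<dots> \<le> B" by (rule conv_integral_le[OF g(1) u_dominated bspec[OF B]])
    finally show ?thesis .
  qed
  then show ?thesis by blast
qed

text \<open>Following \<open>\<tau>1\<close> on \<open>A\<close> and \<open>\<tau>2\<close> off
  \<open>A\<close> gives, with \<open>Y1\<close> and \<open>Y2\<close> the two stopped values, the
  payoff \<open>lam * Y1 + (1 - lam) * Y2 - (indicator A - lam) * (Y2 - Y1)\<close>. Assumption (A)
  makes the last term cost less than \<open>e\<close>, for all densities at once.\<close>

lemma simple_times_pasting_nearly_concave:
  assumes A: "\<forall>\<tau>1\<in>nonzero_finite_stopping_times P F T. \<forall>\<tau>2\<in>nonzero_finite_stopping_times P F T.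
      (INF A\<in>stopped_sets P F T (\<lambda>\<omega>. min (\<tau>1 \<omega>) (\<tau>2 \<omega>)).
         rhoQ Qs (\<lambda>\<omega>. (indicator A \<omega> - lam) * (stopped Y \<tau>2 \<omega> - stopped Y \<tau>1 \<omega>))) \<le> 0"
    and \<tau>: "\<tau>1 \<in> simple_times" "\<tau>2 \<in> simple_times" and e: "0 < e"
  shows "\<exists>\<tau>\<in>simple_times. \<forall>g\<in>conv_densities.
      lam * (\<integral>\<omega>. g \<omega> * stopped Y \<tau>1 \<omega> \<partial>P) + (1 - lam) * (\<integral>\<omega>. g \<omega> * stopped Y \<tau>2 \<omega> \<partial>P) - e
        \<le> (\<integral>\<omega>. g \<omega> * stopped Y \<tau> \<omega> \<partial>P)"
proof -
  let ?S = "stopped_sets P F T (\<lambda>\<omega>. min (\<tau>1 \<omega>) (\<tau>2 \<omega>))"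
  define f where "f A \<omega> = (indicator A \<omega> - lam) * (stopped Y \<tau>2 \<omega> - stopped Y \<tau>1 \<omega>)" for A \<omega>
  \<comment> \<open>The empty event belongs to the family, so the infimum is over a nonempty set and
    some event has value below \<open>e\<close>.\<close>
  have "{} \<in> ?S" by (simp add: stopped_sets_def)
  then have ne: "(\<lambda>A. rhoQ Qs (f A)) ` ?S \<noteq> {}" by blast
  have "(INF A\<in>?S. rhoQ Qs (f A)) \<le> 0"
    using A simple_times_nonzero[OF \<tau>(1)] simple_times_nonzero[OF \<tau>(2)] unfolding f_def by blast
  then have "(INF A\<in>?S. rhoQ Qs (f A)) < e" using e by (rule le_less_trans)
  from cInf_lessD[OF ne this] obtain A where A: "A \<in> ?S" "rhoQ Qs (f A) < e" by blast
  note d1 = stopped_dominated[OF simple_times_ST[OF \<tau>(1)]] and d2 = stopped_dominated[OF simple_times_ST[OF \<tau>(2)]]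
  have [measurable]: "A \<in> sets P" using A(1) by (simp add: stopped_sets_def)
  note [measurable] = stopped_measurable_simple[OF \<tau>(1)] stopped_measurable_simple[OF \<tau>(2)]
  have f_dom: "f A \<in> dominated"
  proof (rule dominatedI[of _ "(1 + \<bar>lam\<bar>) * 2"])
    show "f A \<in> borel_measurable P" unfolding f_def by measurable
    fix \<omega> assume w: "\<omega> \<in> space P"
    have "\<bar>indicator A \<omega> - lam\<bar> \<le> 1 + \<bar>lam\<bar>" by (auto simp: indicator_def)
    moreover have "\<bar>stopped Y \<tau>2 \<omega> - stopped Y \<tau>1 \<omega>\<bar> \<le> 2 * u \<omega>"
      unfolding mult_2
      by (rule order_trans[OF abs_triangle_ineq4
            add_mono[OF stopped_le_u[OF simple_times_ST[OF \<tau>(2)] w] stopped_le_u[OF simple_times_ST[OF \<tau>(1)] w]]])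
    ultimately have "\<bar>indicator A \<omega> - lam\<bar> * \<bar>stopped Y \<tau>2 \<omega> - stopped Y \<tau>1 \<omega>\<bar> \<le> (1 + \<bar>lam\<bar>) * (2 * u \<omega>)"
      by (rule mult_mono) auto
    then show "\<bar>f A \<omega>\<bar> \<le> (1 + \<bar>lam\<bar>) * 2 * u \<omega>" unfolding f_def abs_mult mult.assoc .
  qed
  define \<tau> where "\<tau> \<omega> = (if \<omega> \<in> A then \<tau>1 \<omega> else \<tau>2 \<omega>)" for \<omega>
  have \<tau>C: "\<tau> \<in> simple_times" unfolding \<tau>_def by (rule simple_times_paste[OF \<open>\<tau>1 \<in> simple_times\<close> \<open>\<tau>2 \<in> simple_times\<close> A(1)])
  show ?thesis
  proof (intro bexI[OF _ \<tau>C] ballI)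
    fix g assume g: "g \<in> conv_densities"
    have pt: "g \<omega> * stopped Y \<tau> \<omega> = lam * (g \<omega> * stopped Y \<tau>1 \<omega>) + (1 - lam) * (g \<omega> * stopped Y \<tau>2 \<omega>) - g \<omega> * f A \<omega>" for \<omega>
      by (cases "\<omega> \<in> A") (simp_all add: f_def \<tau>_def stopped_def algebra_simps)
    have "(\<integral>\<omega>. g \<omega> * f A \<omega> \<partial>P) \<le> rhoQ Qs (f A)"
      by (rule conv_integral_le[OF g f_dom integral_le_rhoQ[OF f_dom]])
    moreover have "(\<integral>\<omega>. g \<omega> * stopped Y \<tau> \<omega> \<partial>P) =
        lam * (\<integral>\<omega>. g \<omega> * stopped Y \<tau>1 \<omega> \<partial>P) + (1 - lam) * (\<integral>\<omega>. g \<omega> * stopped Y \<tau>2 \<omega> \<partial>P)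
        - (\<integral>\<omega>. g \<omega> * f A \<omega> \<partial>P)"
    proof -
      note i = conv_integrable[OF g d1] conv_integrable[OF g d2] conv_integrable[OF g f_dom]
      show ?thesis
        unfolding pt Bochner_Integration.integral_diff[OF Bochner_Integration.integrable_add[OF
            integrable_mult_right[OF i(1)] integrable_mult_right[OF i(2)]] i(3)]
          Bochner_Integration.integral_add[OF integrable_mult_right[OF i(1)] integrable_mult_right[OF i(2)]]
        by simp
    qed
    ultimately show "lam * (\<integral>\<omega>. g \<omega> * stopped Y \<tau>1 \<omega> \<partial>P) + (1 - lam) * (\<integral>\<omega>. g \<omega> * stopped Y \<tau>2 \<omega> \<partial>P) - e
        \<le> (\<integral>\<omega>. g \<omega> * stopped Y \<tau> \<omega> \<partial>P)" using A(2) by linarith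
  qed
qed

lemma Qs_nonempty: "Qs \<noteq> {}"
  using Qs by (simp add: admissible_measures_def)

text \<open>Integrals are affine in the measure, so averaging produces no value below the infimum
  over \<open>Qs\<close>. This settles the first equality for each stopping time separately.\<close>

lemma INF_conv_eq:
  assumes X: "X \<in> dominated"
  shows "(INF Q\<in>conv_measures P Qs. \<integral>\<omega>. X \<omega> \<partial>Q) = (INF Q\<in>Qs. \<integral>\<omega>. X \<omega> \<partial>Q)"
proof -
  obtain K where K: "\<forall>Q\<in>Qs. \<bar>\<integral>\<omega>. X \<omega> \<partial>Q\<bar> \<le> K" using dominated_integral_bound[OF X] by blast
  have ge: "b \<le> (\<integral>\<omega>. X \<omega> \<partial>Q)" if Q: "Q \<in> conv_measures P Qs" and b: "\<And>R. R \<in> Qs \<Longrightarrow> b \<le> (\<integral>\<omega>. X \<omega> \<partial>R)" for b Q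
  proof -
    obtain g where g: "g \<in> conv_densities" "Q = density P (\<lambda>\<omega>. ennreal (g \<omega>))"
      using Q unfolding conv_measures_eq by blast
    show ?thesis unfolding g(2) conv_integral[OF g(1) X] by (rule conv_integral_ge[OF g(1) X b])
  qed
  have K': "- K \<le> (\<integral>\<omega>. X \<omega> \<partial>Q)" if "Q \<in> Qs" for Q using bspec[OF K that] by linarith
  have bdd: "bdd_below ((\<lambda>Q. \<integral>\<omega>. X \<omega> \<partial>Q) ` Qs)"
    by (rule bdd_belowI2[of _ "- K"]) (rule K')
  have bdd': "bdd_below ((\<lambda>Q. \<integral>\<omega>. X \<omega> \<partial>Q) ` conv_measures P Qs)"
    by (rule bdd_belowI2[of _ "- K"]) (rule ge[OF _ K'])
  show ?thesis
  proof (rule antisym)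
    show "(INF Q\<in>conv_measures P Qs. \<integral>\<omega>. X \<omega> \<partial>Q) \<le> (INF Q\<in>Qs. \<integral>\<omega>. X \<omega> \<partial>Q)"
      by (rule cINF_superset_mono[OF Qs_nonempty bdd' Qs_subset_conv]) simp
    show "(INF Q\<in>Qs. \<integral>\<omega>. X \<omega> \<partial>Q) \<le> (INF Q\<in>conv_measures P Qs. \<integral>\<omega>. X \<omega> \<partial>Q)"
    proof (rule cINF_greatest)
      show "conv_measures P Qs \<noteq> {}" using Qs_nonempty Qs_subset_conv by blast
    qed (rule ge, assumption, rule cINF_lower[OF bdd])
  qed
qed

text \<open>Only the inequality from upper to lower value is substantial. The abstract minimax is
  played with \<open>simple_times\<close>: with them the lower value cannot exceed \<open>V\<close>,
  and by approximation the upper value is not diminished.\<close>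

lemma minimax:
  assumes lam: "0 < lam" "lam < 1"
    and A: "\<forall>\<tau>1\<in>nonzero_finite_stopping_times P F T. \<forall>\<tau>2\<in>nonzero_finite_stopping_times P F T.
      (INF A\<in>stopped_sets P F T (\<lambda>\<omega>. min (\<tau>1 \<omega>) (\<tau>2 \<omega>)).
         rhoQ Qs (\<lambda>\<omega>. (indicator A \<omega> - lam) * (stopped Y \<tau>2 \<omega> - stopped Y \<tau>1 \<omega>))) \<le> 0"
  shows "(SUP \<tau>\<in>ST. INF Q\<in>conv_measures P Qs. \<integral>\<omega>. stopped Y \<tau> \<omega> \<partial>Q)
       = (INF Q\<in>conv_measures P Qs. SUP \<tau>\<in>ST. \<integral>\<omega>. stopped Y \<tau> \<omega> \<partial>Q)"
proof -
  define E where "E Q \<tau> = (\<integral>\<omega>. stopped Y \<tau> \<omega> \<partial>Q)" for Q \<tau>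
  define \<Q> where "\<Q> = conv_measures P Qs"
  define V where "V = (SUP \<tau>\<in>ST. INF Q\<in>\<Q>. E Q \<tau>)"
  define W where "W = (INF Q\<in>\<Q>. SUP \<tau>\<in>ST. E Q \<tau>)"
  obtain B where "\<forall>Q\<in>\<Q>. \<forall>\<tau>\<in>ST. \<bar>E Q \<tau>\<bar> \<le> B"
    using stopped_integral_bound unfolding E_def \<Q>_def by blast
  then have B: "\<bar>E Q \<tau>\<bar> \<le> B" if "Q \<in> \<Q>" "\<tau> \<in> ST" for Q \<tau> using that by blast
  then have B_up: "E Q \<tau> \<le> B" and B_low: "- B \<le> E Q \<tau>" if "Q \<in> \<Q>" "\<tau> \<in> ST" for Q \<tau>
    using B[OF that] by linarith+
  have ne: "\<Q> \<noteq> {}" using Qs_nonempty Qs_subset_conv unfolding \<Q>_def by blast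
  then obtain Q0 where Q0: "Q0 \<in> \<Q>" by blast
  have T_ST: "(\<lambda>\<omega>. T) \<in> ST"
  proof -
    have "{\<omega>\<in>space P. T \<le> t} \<in> sets (F t)" if t: "t \<in> {0..T}" for t
      using sets.top[of "F t"] F_space[OF t] by (cases "T \<le> t") auto
    moreover have "T \<in> {0..T}" using T_pos by simp
    ultimately show ?thesis unfolding stopping_times_def by blast
  qed
  then have ST_ne: "ST \<noteq> {}" by blast
  have INF_le: "(INF Q\<in>\<Q>. E Q \<tau>) \<le> E Q \<tau>" if "\<tau> \<in> ST" "Q \<in> \<Q>" for \<tau> Q
    by (rule cINF_lower[OF bdd_belowI2[of _ "- B"] that(2)]) (rule B_low[OF _ that(1)])
  have bdd_\<tau>: "bdd_above (E Q ` ST)" if "Q \<in> \<Q>" for Q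
    by (rule bdd_aboveI2[of _ _ B]) (rule B_up[OF that])
  have le_SUP: "E Q \<tau> \<le> (SUP \<tau>\<in>ST. E Q \<tau>)" if "\<tau> \<in> ST" "Q \<in> \<Q>" for \<tau> Q
    by (rule cSUP_upper[OF that(1) bdd_\<tau>[OF that(2)]])
  have bdd_V: "bdd_above ((\<lambda>\<tau>. INF Q\<in>\<Q>. E Q \<tau>) ` ST)"
    by (rule bdd_aboveI2[of _ _ B]) (rule order_trans[OF INF_le[OF _ Q0] B_up[OF Q0]])
  have bdd_W: "bdd_below ((\<lambda>Q. SUP \<tau>\<in>ST. E Q \<tau>) ` \<Q>)"
    by (rule bdd_belowI2[of _ "- B"]) (rule order_trans[OF B_low[OF _ T_ST] le_SUP[OF T_ST]])
  have "V \<le> W" unfolding V_def W_def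
    by (intro cSUP_least[OF ST_ne] cINF_greatest[OF ne] order_trans[OF INF_le le_SUP])
  have u_pos: "0 < u \<omega>" if "\<omega> \<in> space P" for \<omega> using Ystar_nonneg[OF that] by simp
  \<comment> \<open>The factor \<open>u\<close> moved from payoff to density cancels pointwise, as
    it is nonzero on the whole space.\<close>
  have weighted: "(\<integral>\<omega>. (g \<omega> * u \<omega>) * (stopped Y \<tau> \<omega> / u \<omega>) \<partial>P) = (\<integral>\<omega>. g \<omega> * stopped Y \<tau> \<omega> \<partial>P)" for g \<tau>
  proof (rule Bochner_Integration.integral_cong[OF refl])
    fix \<omega> assume "\<omega> \<in> space P"
    then have "u \<omega> \<noteq> 0" using u_pos by force
    then show "(g \<omega> * u \<omega>) * (stopped Y \<tau> \<omega> / u \<omega>) = g \<omega> * stopped Y \<tau> \<omega>" by simp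
  qed
  have "W \<le> V"
  proof (rule minimax_uniformly_integrable[where G = "(\<lambda>g \<omega>. g \<omega> * u \<omega>) ` conv_densities"
        and C = simple_times and X = "\<lambda>\<tau> \<omega>. stopped Y \<tau> \<omega> / u \<omega>" and lam = lam])
    fix g assume "g \<in> (\<lambda>g \<omega>. g \<omega> * u \<omega>) ` conv_densities"
    then obtain k where k: "k \<in> conv_densities" "g = (\<lambda>\<omega>. k \<omega> * u \<omega>)" by blast
    show "integrable P g" unfolding k(2) by (rule conv_integrable[OF k(1) u_dominated])
    show "0 \<le> g \<omega>" if "\<omega> \<in> space P" for \<omega>
      unfolding k(2) by (intro mult_nonneg_nonneg conv_densities_props(2)[OF k(1)] less_imp_le[OF u_pos[OF that]])
    show "(\<lambda>\<omega>. t * g \<omega> + (1 - t) * g' \<omega>) \<in> (\<lambda>g \<omega>. g \<omega> * u \<omega>) ` conv_densities"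
      if g': "g' \<in> (\<lambda>g \<omega>. g \<omega> * u \<omega>) ` conv_densities" and t: "0 \<le> t" "t \<le> 1" for g' t
    proof -
      obtain k' where k': "k' \<in> conv_densities" "g' = (\<lambda>\<omega>. k' \<omega> * u \<omega>)" using g' by blast
      show ?thesis unfolding k(2) k'(2)
        by (rule image_eqI[OF _ conv_densities_mix[OF k(1) k'(1) t]]) (simp add: algebra_simps)
    qed
    show "\<exists>\<tau>\<in>simple_times. W - e < (\<integral>\<omega>. g \<omega> * (stopped Y \<tau> \<omega> / u \<omega>) \<partial>P)" if e: "0 < e" for e
    proof -
      define Q where "Q = density P (\<lambda>\<omega>. ennreal (k \<omega>))"
      have Q: "Q \<in> \<Q>" using k(1) unfolding \<Q>_def conv_measures_eq Q_def by blast
      \<comment> \<open>Half of the error pays for a nearly optimal stopping time, the other half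
        for replacing it by a member of \<open>simple_times\<close>.\<close>
      have e2: "0 < e / 2" using e by simp
      have "W \<le> (SUP \<tau>\<in>ST. E Q \<tau>)" unfolding W_def by (rule cINF_lower[OF bdd_W Q])
      then have "W - e / 2 < (SUP \<tau>\<in>ST. E Q \<tau>)" using e2 by linarith
      then obtain \<tau> where \<tau>: "\<tau> \<in> ST" "W - e / 2 < E Q \<tau>"
        using less_cSUP_iff[OF ST_ne bdd_\<tau>[OF Q]] by blast
      have EQ: "E Q \<tau> = (\<integral>\<omega>. k \<omega> * stopped Y \<tau> \<omega> \<partial>P)"
        unfolding Q_def E_def by (rule conv_integral[OF k(1) stopped_dominated[OF \<tau>(1)]])
      obtain \<sigma> where \<sigma>: "\<sigma> \<in> simple_times" "(\<integral>\<omega>. k \<omega> * stopped Y \<tau> \<omega> \<partial>P) - e / 2 < (\<integral>\<omega>. k \<omega> * stopped Y \<sigma> \<omega> \<partial>P)"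
        using simple_times_approximates_integral[OF k(1) \<tau>(1) e2] by blast
      show ?thesis unfolding k(2) weighted
      proof (rule bexI[OF _ \<sigma>(1)])
        show "W - e < (\<integral>\<omega>. k \<omega> * stopped Y \<sigma> \<omega> \<partial>P)" using \<sigma>(2) \<tau>(2) EQ by linarith
      qed
    qed
  next
    fix d :: real assume "0 < d"
    from conv_densities_uniformly_integrable[OF this] obtain N
      where N: "\<forall>g\<in>conv_densities. (\<integral>\<omega>. max (g \<omega> * u \<omega> - N) 0 \<partial>P) \<le> d" by blast
    show "\<exists>N. \<forall>g\<in>(\<lambda>g \<omega>. g \<omega> * u \<omega>) ` conv_densities. (\<integral>\<omega>. max (g \<omega> - N) 0 \<partial>P) \<le> d"
    proof (intro exI[of _ N] ballI)
      fix g assume "g \<in> (\<lambda>g \<omega>. g \<omega> * u \<omega>) ` conv_densities"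
      then obtain k where k: "k \<in> conv_densities" "g = (\<lambda>\<omega>. k \<omega> * u \<omega>)" by blast
      show "(\<integral>\<omega>. max (g \<omega> - N) 0 \<partial>P) \<le> d" unfolding k(2) by (rule bspec[OF N k(1)])
    qed
  next
    fix \<tau> assume \<tau>: "\<tau> \<in> simple_times"
    note [measurable] = stopped_measurable_simple[OF \<tau>]
    show "(\<lambda>\<omega>. stopped Y \<tau> \<omega> / u \<omega>) \<in> borel_measurable P" by measurable
    show "\<bar>stopped Y \<tau> \<omega> / u \<omega>\<bar> \<le> 1" if "\<omega> \<in> space P" for \<omega>
    proof -
      have "\<bar>stopped Y \<tau> \<omega> / u \<omega>\<bar> = \<bar>stopped Y \<tau> \<omega>\<bar> / u \<omega>"
        unfolding abs_divide abs_of_pos[OF u_pos[OF that]] ..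
      also have "\<dots> \<le> 1"
        unfolding pos_divide_le_eq[OF u_pos[OF that]] mult_1 by (rule stopped_le_u[OF simple_times_ST[OF \<tau>] that])
      finally show ?thesis .
    qed
    show "\<exists>g\<in>(\<lambda>g \<omega>. g \<omega> * u \<omega>) ` conv_densities. (\<integral>\<omega>. g \<omega> * (stopped Y \<tau> \<omega> / u \<omega>) \<partial>P) < V + e"
      if e: "0 < e" for e
    proof -
      \<comment> \<open>By the equality of the two infima a near-minimizer can be taken in
        \<open>Qs\<close> itself, where its density is directly available.\<close>
      have "(INF Q\<in>Qs. E Q \<tau>) = (INF Q\<in>\<Q>. E Q \<tau>)"
        unfolding E_def \<Q>_def by (rule INF_conv_eq[OF stopped_dominated[OF simple_times_ST[OF \<tau>]], symmetric])
      also have "\<dots> \<le> V" unfolding V_def by (rule cSUP_upper[OF simple_times_ST[OF \<tau>] bdd_V])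
      also have "V < V + e" using e by simp
      finally have "(INF Q\<in>Qs. E Q \<tau>) < V + e" .
      then obtain Q where Q: "Q \<in> Qs" "E Q \<tau> < V + e"
        using cInf_lessD[of "(\<lambda>Q. E Q \<tau>) ` Qs" "V + e"] Qs_nonempty by blast
      have "(\<integral>\<omega>. (dens Q \<omega> * u \<omega>) * (stopped Y \<tau> \<omega> / u \<omega>) \<partial>P) = E Q \<tau>"
        unfolding weighted E_def by (rule dens_integral(2)[OF Q(1) stopped_dominated[OF simple_times_ST[OF \<tau>]], symmetric])
      then show ?thesis
        using Q(2) by (intro bexI[OF _ imageI[OF dens_conv_densities[OF Q(1)]]]) simp
    qed
    show "\<exists>\<tau>'\<in>simple_times. \<forall>g\<in>(\<lambda>g \<omega>. g \<omega> * u \<omega>) ` conv_densities.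
        lam * (\<integral>\<omega>. g \<omega> * (stopped Y \<tau> \<omega> / u \<omega>) \<partial>P) + (1 - lam) * (\<integral>\<omega>. g \<omega> * (stopped Y \<tau>2 \<omega> / u \<omega>) \<partial>P) - e
          \<le> (\<integral>\<omega>. g \<omega> * (stopped Y \<tau>' \<omega> / u \<omega>) \<partial>P)"
      if \<tau>2: "\<tau>2 \<in> simple_times" and e: "0 < e" for \<tau>2 e
    proof -
      obtain \<tau>' where \<tau>': "\<tau>' \<in> simple_times" "\<forall>g\<in>conv_densities.
          lam * (\<integral>\<omega>. g \<omega> * stopped Y \<tau> \<omega> \<partial>P) + (1 - lam) * (\<integral>\<omega>. g \<omega> * stopped Y \<tau>2 \<omega> \<partial>P) - e
            \<le> (\<integral>\<omega>. g \<omega> * stopped Y \<tau>' \<omega> \<partial>P)"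
        using simple_times_pasting_nearly_concave[OF A \<tau> \<tau>2 e] by blast
      show ?thesis
      proof (intro bexI[OF _ \<tau>'(1)] ballI)
        fix g assume "g \<in> (\<lambda>g \<omega>. g \<omega> * u \<omega>) ` conv_densities"
        then obtain k where k: "k \<in> conv_densities" "g = (\<lambda>\<omega>. k \<omega> * u \<omega>)" by blast
        show "lam * (\<integral>\<omega>. g \<omega> * (stopped Y \<tau> \<omega> / u \<omega>) \<partial>P) + (1 - lam) * (\<integral>\<omega>. g \<omega> * (stopped Y \<tau>2 \<omega> / u \<omega>) \<partial>P) - e
            \<le> (\<integral>\<omega>. g \<omega> * (stopped Y \<tau>' \<omega> / u \<omega>) \<partial>P)"
          unfolding k(2) weighted by (rule bspec[OF \<tau>'(2) k(1)])
      qed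
    qed
  next
    show "(\<lambda>g \<omega>. g \<omega> * u \<omega>) ` conv_densities \<noteq> {}" using Qs_nonempty dens_conv_densities by blast
  qed (rule lam)+
  with \<open>V \<le> W\<close> show ?thesis unfolding V_def W_def E_def \<Q>_def by (rule antisym)
qed

end

theorem theorem5p1:
  fixes P :: "'a measure" and F :: "real \<Rightarrow> 'a measure" and T :: real
    and Y :: "real \<Rightarrow> 'a \<Rightarrow> real" and Qs :: "'a measure set"
  assumes setting: "filtered_setting P F T"
    and Y: "admissible_process P F T Y"
    and Qs: "admissible_measures P Qs"
    and L1: "Ystar T Y \<in> L1Q P Qs"
    and cont: "continuous_from_above_at_0 P T Y Qs"
    and A: "\<exists>lam::real. 0 < lam \<and> lam < 1 \<and>
              (\<forall>\<tau>1\<in>nonzero_finite_stopping_times P F T. \<forall>\<tau>2\<in>nonzero_finite_stopping_times P F T.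
                 (INF A\<in>stopped_sets P F T (\<lambda>\<omega>. min (\<tau>1 \<omega>) (\<tau>2 \<omega>)).
                    rhoQ Qs (\<lambda>\<omega>. (indicator A \<omega> - lam) * (stopped Y \<tau>2 \<omega> - stopped Y \<tau>1 \<omega>))) \<le> 0)"
  shows "(SUP \<tau>\<in>stopping_times P F T. INF Q\<in>Qs. \<integral>\<omega>. stopped Y \<tau> \<omega> \<partial>Q)
           = (SUP \<tau>\<in>stopping_times P F T. INF Q\<in>conv_measures P Qs. \<integral>\<omega>. stopped Y \<tau> \<omega> \<partial>Q)
       \<and> (SUP \<tau>\<in>stopping_times P F T. INF Q\<in>conv_measures P Qs. \<integral>\<omega>. stopped Y \<tau> \<omega> \<partial>Q)
           = (INF Q\<in>conv_measures P Qs. SUP \<tau>\<in>stopping_times P F T. \<integral>\<omega>. stopped Y \<tau> \<omega> \<partial>Q)"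
proof -
  interpret robust_stopping P F T Y Qs
    by (rule robust_stopping.intro[OF setting Y Qs L1 cont])
  obtain lam :: real where lam: "0 < lam" "lam < 1"
    and paste: "\<forall>\<tau>1\<in>nonzero_finite_stopping_times P F T. \<forall>\<tau>2\<in>nonzero_finite_stopping_times P F T.
      (INF A\<in>stopped_sets P F T (\<lambda>\<omega>. min (\<tau>1 \<omega>) (\<tau>2 \<omega>)).
         rhoQ Qs (\<lambda>\<omega>. (indicator A \<omega> - lam) * (stopped Y \<tau>2 \<omega> - stopped Y \<tau>1 \<omega>))) \<le> 0"
    using A by blast
  have "(SUP \<tau>\<in>ST. INF Q\<in>Qs. \<integral>\<omega>. stopped Y \<tau> \<omega> \<partial>Q) = (SUP \<tau>\<in>ST. INF Q\<in>conv_measures P Qs. \<integral>\<omega>. stopped Y \<tau> \<omega> \<partial>Q)"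
    by (rule SUP_cong[OF refl]) (rule INF_conv_eq[OF stopped_dominated, symmetric])
  then show ?thesis using minimax[OF lam paste] by (rule conjI)
qed

end
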